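(* Let $\{P_n\}_{n\ge0}$ be a sequence of orthogonal polynomials of one of the following types: Wilson polynomials, continuous dual Hahn polynomials, Askey--Wilson polynomials, or special cases or limiting cases of Askey--Wilson polynomials as one or more of the parameters $a,b,c,d$ tend to $\infty$. Then there exist sequences $\{b_{n,n+j}\}$, $j=-2,\dots,2$, such that $$P_n(x)=\sum_{j=-2}^{2}b_{n,n+j}\,\mathbb{D}_x^2P_{n+j}(x),\qquad n=2,3,\dots.$$
   Context: For a lattice $x(s)$ and a polynomial $f$, $\mathbb{D}_xf(x(s))=\dfrac{f(x(s+\frac12))-f(x(s-\frac12))}{x(s+\frac12)-x(s-\frac12)}$, a polynomial in $x$. For Askey--Wilson polynomials and their special/limiting cases the lattice is $x(s)=\frac{q^{-s}+q^{s}}2$ ($q>0$, $q\neq1$) and $P_n(x)$ is a polynomial in $x=\cos\theta$, $q^s=e^{i\theta}$. For Wilson and continuous dual Hahn polynomials the lattice is $x(z)=z^2$, $z=is$, $i^2=-1$, and $P_n$ is regarded as a polynomial in $x$ through $s^2=-x$. Notation: $(a;q)_k=\prod_{j=0}^{k-1}(1-aq^j)$, $(a)_k=\prod_{j=0}^{k-1}(a+j)$; ${}_{s+1}\phi_s(a_1,\dots,a_{s+1};b_1,\dots,b_s;q,z)=\sum_{k\ge0}\frac{(a_1;q)_k\cdots(a_{s+1};q)_k}{(b_1;q)_k\cdots(b_s;q)_k}\frac{z^k}{(q;q)_k}$; ${}_{s+1}F_s(a_1,\dots,a_{s+1};b_1,\dots,b_s;z)=\sum_{k\ge0}\frac{(a_1)_k\cdots(a_{s+1})_k}{(b_1)_k\cdots(b_s)_k}\frac{z^k}{k!}$.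 Askey--Wilson polynomials: $\dfrac{a^np_n(x;a,b,c,d|q)}{(ab;q)_n(ac;q)_n(ad;q)_n}={}_4\phi_3(q^{-n},abcdq^{n-1},ae^{-i\theta},ae^{i\theta};ab,ac,ad;q,q)$, $x=\cos\theta$ (extended by continuity in the parameters). Wilson: $\dfrac{W_n(s^2;a,b,c,d)}{(a+b)_n(a+c)_n(a+d)_n}={}_4F_3(-n,n+a+b+c+d-1,a-is,a+is;a+b,a+c,a+d;1)$. Continuous dual Hahn: $\dfrac{S_n(s^2;a,b,c)}{(a+b)_n(a+c)_n}={}_3F_2(-n,a-is,a+is;a+b,a+c;1)$. "Limiting cases" means coefficientwise limits of the monic multiples of $p_n$ as one or more parameters tend to $\infty$. Orthogonal means orthogonal with respect to a positive measure. *)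

theory Defs
  imports "HOL-Analysis.Analysis" "HOL-Computational_Algebra.Polynomial"
begin

definition q_lattice :: "complex \<Rightarrow> complex \<Rightarrow> complex" where
  "q_lattice q s = (q powr (- s) + q powr s) / 2"

definition square_lattice :: "complex \<Rightarrow> complex" where
  "square_lattice z = z\<^sup>2"

text \<open>The quotient is prescribed only where its denominator does not vanish; for the two lattices
  above this determines the polynomial (see \<open>q_lattice_ddiff\<close> and \<open>square_lattice_ddiff\<close>).\<close>

definition is_ddiff :: "(complex \<Rightarrow> complex) \<Rightarrow> complex poly \<Rightarrow> complex poly \<Rightarrow> bool" where
  "is_ddiff x f g \<longleftrightarrow> (\<forall>s. x (s + 1/2) \<noteq> x (s - 1/2) \<longrightarrow>
     poly g (x s) = (poly f (x (s + 1/2)) - poly f (x (s - 1/2))) / (x (s + 1/2) - x (s - 1/2)))"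

definition ddiff :: "(complex \<Rightarrow> complex) \<Rightarrow> complex poly \<Rightarrow> complex poly" where
  "ddiff x f = (THE g. is_ddiff x f g)"

lemma poly_eq_on_infinite:
  fixes p q :: "'a::idom poly"
  assumes "infinite S" "\<And>y. y \<in> S \<Longrightarrow> poly p y = poly q y"
  shows "p = q"
proof (rule ccontr)
  assume "p \<noteq> q"
  hence "finite {y. poly (p - q) y = 0}" by (intro poly_roots_finite) auto
  moreover have "S \<subseteq> {y. poly (p - q) y = 0}" using assms(2) by auto
  ultimately show False using assms(1) finite_subset by blast
qed

lemma is_ddiff_ex1:
  fixes x :: "complex \<Rightarrow> complex" and f S T :: "complex poly"
  assumes S: "\<And>s. x (s + 1/2) + x (s - 1/2) = poly S (x s)"
    and T: "\<And>s. x (s + 1/2) * x (s - 1/2) = poly T (x s)"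
    and inf: "infinite (x ` {s. x (s + 1/2) \<noteq> x (s - 1/2)})"
  shows "\<exists>!g. is_ddiff x f g"
proof -
  define H where "H = rec_nat ((0::complex poly), (1::complex poly))
                        (\<lambda>_ (h0, h1). (h1, S * h1 - T * h0))"
  define h where "h n = fst (H n)" for n
  have HS: "H (Suc n) = (snd (H n), S * snd (H n) - T * fst (H n))" for n
    by (simp add: H_def split: prod.split)
  have h0: "h 0 = 0" "h (Suc 0) = 1" by (simp_all add: h_def HS) (simp_all add: H_def)
  have hS: "h (Suc (Suc n)) = S * h (Suc n) - T * h n" for n by (simp add: h_def HS)
  have h: "poly (h n) (x s) * (x (s + 1/2) - x (s - 1/2)) = x (s + 1/2) ^ n - x (s - 1/2) ^ n"
    for n s
  proof (induction n rule: induct_nat_012)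
    case (ge2 n)
    let ?u = "x (s + 1/2)" and ?v = "x (s - 1/2)"
    have "poly (h (Suc (Suc n))) (x s) * (?u - ?v)
       = (?u + ?v) * (poly (h (Suc n)) (x s) * (?u - ?v)) - ?u * ?v * (poly (h n) (x s) * (?u - ?v))"
      unfolding hS poly_diff poly_mult S[of s] T[of s] by (simp add: algebra_simps)
    also have "\<dots> = ?u ^ Suc (Suc n) - ?v ^ Suc (Suc n)"
      unfolding ge2 by (simp add: algebra_simps)
    finally show ?case .
  qed (simp_all add: h0)
  let ?g = "\<Sum>i\<le>degree f. smult (coeff f i) (h i)"
  have "is_ddiff x f ?g"
    unfolding is_ddiff_def
  proof (intro allI impI)
    fix s assume ne: "x (s + 1/2) \<noteq> x (s - 1/2)"
    have "poly ?g (x s) * (x (s + 1/2) - x (s - 1/2))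
        = (\<Sum>i\<le>degree f. coeff f i * (poly (h i) (x s) * (x (s + 1/2) - x (s - 1/2))))"
      by (simp add: poly_sum sum_distrib_right mult.assoc)
    also have "\<dots> = poly f (x (s + 1/2)) - poly f (x (s - 1/2))"
      unfolding h by (simp add: poly_altdef right_diff_distrib sum_subtractf)
    finally show "poly ?g (x s) =
        (poly f (x (s + 1/2)) - poly f (x (s - 1/2))) / (x (s + 1/2) - x (s - 1/2))"
      using ne by (simp add: field_simps)
  qed
  moreover have "g = g'" if "is_ddiff x f g" "is_ddiff x f g'" for g g'
    by (rule poly_eq_on_infinite[OF inf]) (use that in \<open>auto simp: is_ddiff_def\<close>)
  ultimately show ?thesis by blast
qed

lemma square_lattice_ddiff: "is_ddiff square_lattice f (ddiff square_lattice f)"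
proof -
  have "\<exists>!g. is_ddiff square_lattice f g"
  proof (rule is_ddiff_ex1)
    fix s
    show "square_lattice (s + 1/2) + square_lattice (s - 1/2) = poly [:1/2, 2:] (square_lattice s)"
      by (simp add: square_lattice_def power2_eq_square field_simps)
    show "square_lattice (s + 1/2) * square_lattice (s - 1/2)
            = poly [:1/16, -1/2, 1:] (square_lattice s)"
      by (simp add: square_lattice_def power2_eq_square field_simps)
  next
    have eq: "{s. square_lattice (s + 1/2) \<noteq> square_lattice (s - 1/2)} = - {0}"
      by (auto simp: square_lattice_def power2_eq_square field_simps)
    have "(\<lambda>n. of_nat (Suc n ^ 2)) ` UNIV \<subseteq> square_lattice ` (- {0})"
    proof (rule image_subsetI)
      fix n :: nat
      have "(of_nat (Suc n ^ 2) :: complex) = square_lattice (of_nat (Suc n))"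
        by (simp add: square_lattice_def)
      moreover have "(of_nat (Suc n) :: complex) \<in> - {0}"
        by (simp del: of_nat_Suc)
      ultimately show "(of_nat (Suc n ^ 2) :: complex) \<in> square_lattice ` (- {0})" by blast
    qed
    moreover have "inj (\<lambda>n. of_nat (Suc n ^ 2) :: complex)"
      by (rule injI) (simp del: of_nat_Suc of_nat_power)
    ultimately show "infinite (square_lattice ` {s. square_lattice (s + 1/2) \<noteq> square_lattice (s - 1/2)})"
      unfolding eq by (metis infinite_UNIV_nat finite_imageD finite_subset)
  qed
  thus ?thesis unfolding ddiff_def by (rule theI')
qed

lemma q_lattice_ddiff:
  fixes q :: real
  assumes q: "q > 0" "q \<noteq> 1"
  shows "is_ddiff (q_lattice q) f (ddiff (q_lattice q) f)"
proof -
  let ?x = "q_lattice (complex_of_real q)"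
  define r where "r = complex_of_real q powr (1/2)"
  have r0: "r \<noteq> 0" using q by (simp add: r_def)
  have x: "?x s = (inverse (complex_of_real q powr s) + complex_of_real q powr s) / 2" for s
    by (simp add: q_lattice_def powr_minus)
  have xp: "?x (s + 1/2) = (inverse (complex_of_real q powr s * r) + complex_of_real q powr s * r) / 2" for s
    unfolding x r_def by (simp add: powr_add)
  have xm: "?x (s - 1/2) = (inverse (complex_of_real q powr s / r) + complex_of_real q powr s / r) / 2" for s
    unfolding x r_def by (simp add: powr_diff)
  have s0: "complex_of_real q powr s \<noteq> 0" for s using q by simp
  have "\<exists>!g. is_ddiff ?x f g"
  proof (rule is_ddiff_ex1)
    fix s
    show "?x (s + 1/2) + ?x (s - 1/2) = poly [:0, r + inverse r:] (?x s)"
      unfolding xp xm unfolding x using s0[of s] r0 by (simp add: field_simps)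
    show "?x (s + 1/2) * ?x (s - 1/2) = poly [:(r - inverse r)^2 / 4, 0, 1:] (?x s)"
      unfolding xp xm unfolding x using s0[of s] r0
      by (simp add: power2_eq_square divide_simps) (simp add: algebra_simps)
  next
    define g where "g = (\<lambda>t. complex_of_real (cosh (t * ln q)))"
    have xg: "?x (of_real t) = g t" for t
    proof -
      have "complex_of_real q powr (of_real t) = of_real (exp (t * ln q))"
        using q powr_of_real[of q t] by (simp add: powr_def[of q t])
      thus ?thesis unfolding x g_def
        by (simp add: cosh_def exp_minus field_simps del: of_real_exp)
    qed
    have ln0: "ln q \<noteq> 0" using q by simp
    have inj: "t = u \<or> t = - u" if "g t = g u" for t u
    proof -
      have "cosh \<bar>t * ln q\<bar> = cosh \<bar>u * ln q\<bar>" using that by (simp add: g_def)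
      hence "\<bar>t * ln q\<bar> = \<bar>u * ln q\<bar>"
        using cosh_real_strict_mono[of "\<bar>t * ln q\<bar>" "\<bar>u * ln q\<bar>"]
          cosh_real_strict_mono[of "\<bar>u * ln q\<bar>" "\<bar>t * ln q\<bar>"] by force
      thus ?thesis using ln0 by (auto simp: abs_mult abs_eq_iff)
    qed
    have "g ` {0<..} \<subseteq> ?x ` {s. ?x (s + 1/2) \<noteq> ?x (s - 1/2)}"
    proof (rule image_subsetI)
      fix t :: real assume t: "t \<in> {0<..}"
      have "?x (of_real t + 1/2) = g (t + 1/2)" "?x (of_real t - 1/2) = g (t - 1/2)"
        using xg[of "t + 1/2"] xg[of "t - 1/2"] by simp_all
      hence "?x (of_real t + 1/2) \<noteq> ?x (of_real t - 1/2)"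
        using inj[of "t + 1/2" "t - 1/2"] t by auto
      thus "g t \<in> ?x ` {s. ?x (s + 1/2) \<noteq> ?x (s - 1/2)}"
        using xg[of t] by (metis (mono_tags, lifting) image_eqI mem_Collect_eq)
    qed
    moreover have "inj_on g {0<..}"
      by (rule inj_onI) (use inj in fastforce)
    hence "infinite (g ` {0<..})" by (simp add: finite_image_iff infinite_Ioi)
    ultimately show "infinite (?x ` {s. ?x (s + 1/2) \<noteq> ?x (s - 1/2)})"
      by (rule infinite_super)
  qed
  thus ?thesis unfolding ddiff_def by (rule theI')
qed

definition qpochhammer :: "complex \<Rightarrow> complex \<Rightarrow> nat \<Rightarrow> complex" where
  "qpochhammer a q k = (\<Prod>j<k. 1 - a * q ^ j)"

definition hyper_F :: "complex list \<Rightarrow> complex list \<Rightarrow> complex \<Rightarrow> complex" where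
  "hyper_F as bs z = (\<Sum>k. (\<Prod>a\<leftarrow>as. pochhammer a k) / (\<Prod>b\<leftarrow>bs. pochhammer b k) * (z ^ k / fact k))"

definition hyper_phi :: "complex list \<Rightarrow> complex list \<Rightarrow> complex \<Rightarrow> complex \<Rightarrow> complex" where
  "hyper_phi as bs q z =
     (\<Sum>k. (\<Prod>a\<leftarrow>as. qpochhammer a q k) / (\<Prod>b\<leftarrow>bs. qpochhammer b q k) * (z ^ k / qpochhammer q q k))"

text \<open>Each family is first defined at the parameters where its hypergeometric representation makes
  sense (nonvanishing denominators) and then extended to all parameters by continuity:
  \<open>p\<close> is the member at \<open>u\<close> if it is the coefficientwise limit of the members \<open>F v\<close> as
  \<open>v \<rightarrow> u\<close> within the set \<open>G\<close> of regular parameters.\<close>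

definition continuous_extension ::
    "'p::topological_space set \<Rightarrow> ('p \<Rightarrow> complex poly) \<Rightarrow> 'p \<Rightarrow> complex poly \<Rightarrow> bool" where
  "continuous_extension G F u p \<longleftrightarrow>
     (if u \<in> G then p = F u
      else (\<forall>k. ((\<lambda>v. coeff (F v) k) \<longlongrightarrow> coeff p k) (at u within G)))"

type_synonym param3 = "complex \<times> complex \<times> complex"
type_synonym param4 = "complex \<times> complex \<times> complex \<times> complex"

definition aw_regular :: "complex \<Rightarrow> nat \<Rightarrow> param4 set" where
  "aw_regular q n = {(a, b, c, d). a \<noteq> 0 \<and> qpochhammer (a*b) q n \<noteq> 0 \<and>
      qpochhammer (a*c) q n \<noteq> 0 \<and> qpochhammer (a*d) q n \<noteq> 0}"

definition aw_poly :: "complex \<Rightarrow> nat \<Rightarrow> param4 \<Rightarrow> complex poly" where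
  "aw_poly q n = (\<lambda>(a, b, c, d). THE p. \<forall>\<theta>.
     a ^ n * poly p (cos \<theta>) / (qpochhammer (a*b) q n * qpochhammer (a*c) q n * qpochhammer (a*d) q n)
     = hyper_phi [q powi (- int n), a*b*c*d * q powi (int n - 1), a * exp (- \<i> * \<theta>), a * exp (\<i> * \<theta>)]
         [a*b, a*c, a*d] q q)"

definition is_askey_wilson :: "complex \<Rightarrow> nat \<Rightarrow> param4 \<Rightarrow> complex poly \<Rightarrow> bool" where
  "is_askey_wilson q n u p \<longleftrightarrow> continuous_extension (aw_regular q n) (aw_poly q n) u p"

text \<open>The Wilson and continuous dual Hahn polynomials are polynomials in \<open>x = - s\<^sup>2\<close>, i.e. in
  \<open>x = z\<^sup>2\<close> with \<open>z = \<i> * s\<close>.\<close>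

definition wilson_regular :: "nat \<Rightarrow> param4 set" where
  "wilson_regular n = {(a, b, c, d). pochhammer (a+b) n \<noteq> 0 \<and>
      pochhammer (a+c) n \<noteq> 0 \<and> pochhammer (a+d) n \<noteq> 0}"

definition wilson_poly :: "nat \<Rightarrow> param4 \<Rightarrow> complex poly" where
  "wilson_poly n = (\<lambda>(a, b, c, d). THE p. \<forall>s.
     poly p (- (s\<^sup>2)) / (pochhammer (a+b) n * pochhammer (a+c) n * pochhammer (a+d) n)
     = hyper_F [- of_nat n, of_nat n + a+b+c+d - 1, a - \<i> * s, a + \<i> * s] [a+b, a+c, a+d] 1)"

definition is_wilson :: "nat \<Rightarrow> param4 \<Rightarrow> complex poly \<Rightarrow> bool" where
  "is_wilson n u p \<longleftrightarrow> continuous_extension (wilson_regular n) (wilson_poly n) u p"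

definition cdh_regular :: "nat \<Rightarrow> param3 set" where
  "cdh_regular n = {(a, b, c). pochhammer (a+b) n \<noteq> 0 \<and> pochhammer (a+c) n \<noteq> 0}"

definition cdh_poly :: "nat \<Rightarrow> param3 \<Rightarrow> complex poly" where
  "cdh_poly n = (\<lambda>(a, b, c). THE p. \<forall>s.
     poly p (- (s\<^sup>2)) / (pochhammer (a+b) n * pochhammer (a+c) n)
     = hyper_F [- of_nat n, a - \<i> * s, a + \<i> * s] [a+b, a+c] 1)"

definition is_cdh :: "nat \<Rightarrow> param3 \<Rightarrow> complex poly \<Rightarrow> bool" where
  "is_cdh n u p \<longleftrightarrow> continuous_extension (cdh_regular n) (cdh_poly n) u p"

text \<open>Explicit forms, showing that the definite descriptions above are proper.\<close>

lemma hyper_phi_sum: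
  assumes "q \<noteq> 0"
  shows "hyper_phi (q powi (- int n) # as) bs q z =
     (\<Sum>k\<le>n. qpochhammer (q powi (- int n)) q k * (\<Prod>a\<leftarrow>as. qpochhammer a q k)
        / (\<Prod>b\<leftarrow>bs. qpochhammer b q k) * (z ^ k / qpochhammer q q k))"
proof -
  have "qpochhammer (q powi (- int n)) q k = 0" if "k > n" for k
    unfolding qpochhammer_def using that assms
    by (intro prod_zero) (auto intro!: bexI[of _ n] simp: power_int_minus)
  thus ?thesis unfolding hyper_phi_def
    by (subst suminf_finite[of "{..n}"]) (auto simp: not_le)
qed

lemma hyper_F_sum:
  "hyper_F (- of_nat n # as) bs z =
     (\<Sum>k\<le>n. pochhammer (- of_nat n) k * (\<Prod>a\<leftarrow>as. pochhammer a k)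
        / (\<Prod>b\<leftarrow>bs. pochhammer b k) * (z ^ k / fact k))"
  unfolding hyper_F_def
  by (subst suminf_finite[of "{..n}"]) (auto simp: not_le pochhammer_of_nat_eq_0_lemma)

lemma THE_poly_eqI:
  fixes F p :: "complex poly" and x :: "complex \<Rightarrow> complex" and D :: complex
  assumes "infinite (range x)" "D \<noteq> 0" "e \<noteq> 0" "\<And>t. poly F (x t) = D / e * R t"
  shows "(THE p. \<forall>t. e * poly p (x t) / D = R t) = F"
proof (rule the_equality)
  show "\<forall>t. e * poly F (x t) / D = R t" using assms by (simp add: field_simps)
  fix p assume p: "\<forall>t. e * poly p (x t) / D = R t"
  show "p = F"
  proof (rule poly_eq_on_infinite[OF assms(1)])
    fix y assume "y \<in> range x"
    then obtain t where t: "y = x t" by blast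
    from p have "e * poly p (x t) / D = R t" by blast
    hence "poly p (x t) = D / e * R t" using assms(2,3) by (simp add: field_simps)
    thus "poly p y = poly F y" unfolding t assms(4) .
  qed
qed

lemma aw_poly_explicit:
  assumes "q \<noteq> 0" "(a, b, c, d) \<in> aw_regular q n"
  shows "aw_poly q n (a, b, c, d) =
    smult (qpochhammer (a*b) q n * qpochhammer (a*c) q n * qpochhammer (a*d) q n / a ^ n)
      (\<Sum>k\<le>n. smult (qpochhammer (q powi (- int n)) q k * qpochhammer (a*b*c*d * q powi (int n - 1)) q k
         / (qpochhammer (a*b) q k * qpochhammer (a*c) q k * qpochhammer (a*d) q k) * (q ^ k / qpochhammer q q k))
         (\<Prod>j<k. [:1 + (a * q ^ j)\<^sup>2, - 2 * a * q ^ j:]))"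
proof -
  have inf: "infinite (range (cos :: complex \<Rightarrow> complex))"
  proof
    assume fin: "finite (range (cos :: complex \<Rightarrow> complex))"
    have "of_real ` cos ` {0..pi} \<subseteq> range (cos :: complex \<Rightarrow> complex)"
      by (auto simp: cos_of_real[symmetric])
    hence "finite ((of_real :: real \<Rightarrow> complex) ` cos ` {0..pi})" using fin finite_subset by blast
    hence "finite (cos ` {0..pi::real})"
      by (rule finite_imageD) (simp add: inj_on_def)
    hence "finite {0..pi::real}"
      by (rule finite_imageD) (use cos_inj_pi in \<open>auto simp: inj_on_def\<close>)
    thus False by (simp add: infinite_Icc)
  qed
  have fac: "poly (\<Prod>j<k. [:1 + (a * q ^ j)\<^sup>2, - 2 * a * q ^ j:]) (cos t)
       = qpochhammer (a * exp (- \<i> * t)) q k * qpochhammer (a * exp (\<i> * t)) q k" for k t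
  proof -
    have "1 + (a * q ^ j)\<^sup>2 - 2 * a * q ^ j * cos t
        = (1 - a * exp (- \<i> * t) * q ^ j) * (1 - a * exp (\<i> * t) * q ^ j)" for j
      by (simp add: cos_exp_eq exp_minus power2_eq_square field_simps)
    moreover have "poly [:1 + (a * q ^ j)\<^sup>2, - 2 * a * q ^ j:] (cos t)
        = 1 + (a * q ^ j)\<^sup>2 - 2 * a * q ^ j * cos t" for j
      by simp
    ultimately have "poly [:1 + (a * q ^ j)\<^sup>2, - 2 * a * q ^ j:] (cos t)
        = (1 - a * exp (- \<i> * t) * q ^ j) * (1 - a * exp (\<i> * t) * q ^ j)" for j
      by presburger
    thus ?thesis
      unfolding poly_prod qpochhammer_def prod.distrib[symmetric] by (rule prod.cong[OF refl])
  qed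
  show ?thesis
    unfolding aw_poly_def prod.case
  proof (rule THE_poly_eqI[OF inf])
    show "qpochhammer (a*b) q n * qpochhammer (a*c) q n * qpochhammer (a*d) q n \<noteq> 0" "a ^ n \<noteq> 0"
      using assms(2) by (auto simp: aw_regular_def)
  qed (unfold hyper_phi_sum[OF assms(1)] poly_smult poly_sum fac,
      rule arg_cong[where f = "(*) _"], rule sum.cong[OF refl], simp add: mult_ac)
qed

lemma infinite_neg_squares: "infinite (range (\<lambda>s::complex. - (s\<^sup>2)))"
proof -
  have "range (\<lambda>s::complex. - (s\<^sup>2)) = UNIV"
    by (rule surjI[where f = "\<lambda>y. csqrt (- y)"]) simp
  thus ?thesis by (simp add: infinite_UNIV_char_0)
qed

lemma poly_prod_neg_squares:
  "poly (\<Prod>j<k. [:(a + of_nat j)\<^sup>2, - 1:]) (- (s\<^sup>2))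
     = pochhammer (a - \<i> * s) k * pochhammer (a + \<i> * s) k"
proof -
  have "(a + of_nat j)\<^sup>2 + s\<^sup>2 = (a - \<i> * s + of_nat j) * (a + \<i> * s + of_nat j)" for j
    by (simp add: power2_eq_square algebra_simps)
  thus ?thesis
    by (simp add: poly_prod pochhammer_prod atLeast0LessThan prod.distrib[symmetric])
qed

lemma wilson_poly_explicit:
  assumes "(a, b, c, d) \<in> wilson_regular n"
  shows "wilson_poly n (a, b, c, d) =
    smult (pochhammer (a+b) n * pochhammer (a+c) n * pochhammer (a+d) n)
      (\<Sum>k\<le>n. smult (pochhammer (- of_nat n) k * pochhammer (of_nat n + a+b+c+d - 1) k
         / (pochhammer (a+b) k * pochhammer (a+c) k * pochhammer (a+d) k * fact k))
         (\<Prod>j<k. [:(a + of_nat j)\<^sup>2, - 1:]))"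
  unfolding wilson_poly_def prod.case
proof (rule THE_poly_eqI[OF infinite_neg_squares, where e = 1, unfolded mult_1_left])
  show "pochhammer (a+b) n * pochhammer (a+c) n * pochhammer (a+d) n \<noteq> 0"
    using assms by (auto simp: wilson_regular_def)
  show "(1::complex) \<noteq> 0" by (rule one_neq_zero)
qed (unfold hyper_F_sum poly_smult poly_sum poly_prod_neg_squares div_by_1,
    rule arg_cong[where f = "(*) _"], rule sum.cong[OF refl], simp add: mult_ac)

lemma cdh_poly_explicit:
  assumes "(a, b, c) \<in> cdh_regular n"
  shows "cdh_poly n (a, b, c) =
    smult (pochhammer (a+b) n * pochhammer (a+c) n)
      (\<Sum>k\<le>n. smult (pochhammer (- of_nat n) k / (pochhammer (a+b) k * pochhammer (a+c) k * fact k))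
         (\<Prod>j<k. [:(a + of_nat j)\<^sup>2, - 1:]))"
  unfolding cdh_poly_def prod.case
proof (rule THE_poly_eqI[OF infinite_neg_squares, where e = 1, unfolded mult_1_left])
  show "pochhammer (a+b) n * pochhammer (a+c) n \<noteq> 0"
    using assms by (auto simp: cdh_regular_def)
  show "(1::complex) \<noteq> 0" by (rule one_neq_zero)
qed (unfold hyper_F_sum poly_smult poly_sum poly_prod_neg_squares div_by_1,
    rule arg_cong[where f = "(*) _"], rule sum.cong[OF refl], simp add: mult_ac)

text \<open>Orthogonality is with respect to the Hermitian form, since the normalisation may be complex.\<close>

definition orthogonal_polys :: "(nat \<Rightarrow> complex poly) \<Rightarrow> bool" where
  "orthogonal_polys P \<longleftrightarrow> (\<forall>n. degree (P n) = n) \<and>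
     (\<exists>\<mu> :: real measure. sets \<mu> = sets borel \<and> (\<forall>n. integrable \<mu> (\<lambda>t. t ^ n)) \<and>
        (\<forall>m n. (\<integral>t. poly (P m) (of_real t) * cnj (poly (P n) (of_real t)) \<partial>\<mu>) = 0 \<longleftrightarrow> m \<noteq> n))"

text \<open>A family fixes \<open>P n\<close> up to a nonzero constant.\<close>

definition wilson_type :: "(nat \<Rightarrow> complex poly) \<Rightarrow> bool" where
  "wilson_type P \<longleftrightarrow> (\<exists>u. \<forall>n. \<exists>k p. k \<noteq> 0 \<and> is_wilson n u p \<and> P n = smult k p)"

definition cdh_type :: "(nat \<Rightarrow> complex poly) \<Rightarrow> bool" where
  "cdh_type P \<longleftrightarrow> (\<exists>u. \<forall>n. \<exists>k p. k \<noteq> 0 \<and> is_cdh n u p \<and> P n = smult k p)"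

definition askey_wilson_type :: "complex \<Rightarrow> (nat \<Rightarrow> complex poly) \<Rightarrow> bool" where
  "askey_wilson_type q P \<longleftrightarrow> (\<exists>u. \<forall>n. \<exists>k p. k \<noteq> 0 \<and> is_askey_wilson q n u p \<and> P n = smult k p)"

text \<open>In a limiting case each parameter is either kept fixed or sent to infinity, and at least one
  of them is sent to infinity; allowing arbitrary sequences covers simultaneous as well as
  iterated limits.\<close>

definition tends_to_infinity :: "(nat \<Rightarrow> complex) \<Rightarrow> bool" where
  "tends_to_infinity A \<longleftrightarrow> filterlim A at_infinity sequentially"

definition fixed_or_to_infinity :: "(nat \<Rightarrow> complex) \<Rightarrow> bool" where
  "fixed_or_to_infinity A \<longleftrightarrow> (\<exists>a. A = (\<lambda>_. a)) \<or> tends_to_infinity A"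

definition askey_wilson_limit_type :: "complex \<Rightarrow> (nat \<Rightarrow> complex poly) \<Rightarrow> bool" where
  "askey_wilson_limit_type q P \<longleftrightarrow> (\<exists>A B C D.
     (\<forall>X \<in> {A, B, C, D}. fixed_or_to_infinity X) \<and>
     (\<exists>X \<in> {A, B, C, D}. tends_to_infinity X) \<and>
     (\<forall>n. \<exists>k L Q. k \<noteq> 0 \<and> P n = smult k L \<and>
        (\<forall>\<^sub>F m in sequentially. is_askey_wilson q n (A m, B m, C m, D m) (Q m) \<and> degree (Q m) = n \<and> Q m \<noteq> 0) \<and>
        (\<forall>i. (\<lambda>m. coeff (smult (inverse (lead_coeff (Q m))) (Q m)) i) \<longlonglongrightarrow> coeff L i)))"

end

theory Submission
  imports Defs
begin

text \<open>
  Write \<open>D\<close> for the divided difference and \<open>R\<^sub>n(a, b, c, d)\<close> for the terminating hypergeometric sum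
  defining a Wilson or Askey--Wilson polynomial of degree \<open>n\<close>. Two facts produce the relation when the
  parameters are generic.

  Applying \<open>D\<close> twice maps \<open>R\<^sub>j\<^sub>+\<^sub>2(a, b, c, d)\<close> to a nonzero multiple of \<open>R\<^sub>j(aq, bq, cq, dq)\<close>, or of
  \<open>R\<^sub>j(a + 1, b + 1, c + 1, d + 1)\<close> in the Wilson case (\<open>ddiff_aw_sum\<close>, \<open>ddiff_wilson_sum\<close>). Indeed \<open>D\<close>
  maps the factorial basis for \<open>a\<close> to the one for \<open>a\<close> shifted by half a step and advances each
  factor of the coefficients.

  Conversely, \<open>R\<^sub>n\<close> is a combination of \<open>R\<^sub>n\<close> and \<open>R\<^sub>n\<^sub>-\<^sub>1\<close> with any single one of the four parameters
  shifted by a whole step (\<open>hyper_sum_contiguous\<close>, applied in \<open>aw_sum_step\<close> and \<open>wilson_sum_step\<close>): comparing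
  coefficients, this amounts to writing one linear function of \<open>q\<^sup>k\<close> (or of \<open>k\<close>) as a combination of
  the two linear numerator factors. Shifting the four parameters one after the other expresses
  \<open>R\<^sub>n(a, b, c, d)\<close> through five consecutive polynomials with all parameters shifted, that is, through
  \<open>D\<^sup>2 R\<^sub>n\<^sub>-\<^sub>2, \<dots>, D\<^sup>2 R\<^sub>n\<^sub>+\<^sub>2\<close>. On the analytic side this reflects that the weight for the shifted
  parameters is the original one times a polynomial of degree four.

  The remaining cases are limits of generic ones. Since \<open>D\<^sup>2\<close> lowers degrees by exactly two, the
  polynomials \<open>D\<^sup>2 P\<^sub>m\<close> have distinct degrees, and being a combination of five of them is stable under
  coefficientwise limits as long as the limits \<open>P\<^sub>m\<close> still have degree \<open>m\<close> (\<open>lincomb_limit\<close>,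
  \<open>five_term_relation_limit\<close>); orthogonality enters through this degree condition. Exceptional
  parameters are reached along the curve \<open>(a + t, b + t, c + t, d + t)\<close>, the limiting cases of the
  Askey--Wilson polynomials by one more passage to the limit.
\<close>

section \<open>Linear combinations of indexed families\<close>

definition lincomb :: "nat set \<Rightarrow> (nat \<Rightarrow> complex poly) \<Rightarrow> complex poly set" where
  "lincomb I g = {f. \<exists>c. f = (\<Sum>m\<in>I. smult (c m) (g m))}"

lemma smult_sum_right: "smult c (\<Sum>i\<in>I. f i) = (\<Sum>i\<in>I. smult c (f i))"
  by (induction I rule: infinite_finite_induct) (simp_all add: smult_add_right)

lemma lincombI: "f = (\<Sum>m\<in>I. smult (c m) (g m)) \<Longrightarrow> f \<in> lincomb I g"
  by (auto simp: lincomb_def)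

lemma lincomb_mono:
  assumes "f \<in> lincomb I g" "I \<subseteq> J" "finite J"
  shows "f \<in> lincomb J g"
proof -
  from assms(1) obtain c where c: "f = (\<Sum>m\<in>I. smult (c m) (g m))" by (auto simp: lincomb_def)
  have "f = (\<Sum>m\<in>J. smult (if m \<in> I then c m else 0) (g m))"
    unfolding c using assms(2,3) by (intro sum.mono_neutral_cong_left) auto
  thus ?thesis by (rule lincombI)
qed

lemma lincomb_trans:
  assumes f: "f \<in> lincomb I g" and g: "\<And>m. m \<in> I \<Longrightarrow> g m \<in> lincomb J h"
  shows "f \<in> lincomb J h"
proof -
  from f obtain c where c: "f = (\<Sum>m\<in>I. smult (c m) (g m))" by (auto simp: lincomb_def)
  have "\<forall>m\<in>I. \<exists>d. g m = (\<Sum>k\<in>J. smult (d k) (h k))" using g by (auto simp: lincomb_def)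
  then obtain d where d: "\<And>m. m \<in> I \<Longrightarrow> g m = (\<Sum>k\<in>J. smult (d m k) (h k))" by metis
  have "f = (\<Sum>m\<in>I. \<Sum>k\<in>J. smult (c m * d m k) (h k))"
    unfolding c by (intro sum.cong refl) (simp add: d smult_sum_right)
  also have "\<dots> = (\<Sum>k\<in>J. smult (\<Sum>m\<in>I. c m * d m k) (h k))"
    by (subst sum.swap) (simp add: smult_sum)
  finally show ?thesis by (rule lincombI)
qed

lemma lincomb_chain:
  assumes "\<And>n. f n \<in> lincomb {n - i..n} g" "\<And>n. g n \<in> lincomb {n - j..n} h"
  shows "f n \<in> lincomb {n - (i + j)..n} h"
proof (rule lincomb_trans[OF assms(1)])
  fix m assume "m \<in> {n - i..n}"
  thus "g m \<in> lincomb {n - (i + j)..n} h"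
    by (intro lincomb_mono[OF assms(2)]) auto
qed

lemma lincomb_scale:
  assumes "f \<in> lincomb I g" "\<And>m. m \<in> I \<Longrightarrow> d m \<noteq> 0 \<and> h m = smult (d m) (g m)"
  shows "smult c f \<in> lincomb I h"
proof -
  from assms(1) obtain e where e: "f = (\<Sum>m\<in>I. smult (e m) (g m))" by (auto simp: lincomb_def)
  have "smult c f = (\<Sum>m\<in>I. smult (c * e m / d m) (h m))"
    unfolding e smult_sum_right by (intro sum.cong refl) (use assms(2) in auto)
  thus ?thesis by (rule lincombI)
qed

section \<open>Coefficientwise limits\<close>

definition coeff_tendsto :: "('v \<Rightarrow> complex poly) \<Rightarrow> complex poly \<Rightarrow> 'v filter \<Rightarrow> bool" where
  "coeff_tendsto f p F \<longleftrightarrow> (\<forall>k. ((\<lambda>v. coeff (f v) k) \<longlongrightarrow> coeff p k) F)"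

lemma coeff_tendsto_const: "coeff_tendsto (\<lambda>_. p) p F"
  by (simp add: coeff_tendsto_def)

lemma coeff_tendsto_add:
  "coeff_tendsto f p F \<Longrightarrow> coeff_tendsto g r F \<Longrightarrow> coeff_tendsto (\<lambda>v. f v + g v) (p + r) F"
  by (auto simp: coeff_tendsto_def intro!: tendsto_intros)

lemma coeff_tendsto_smult:
  "(c \<longlongrightarrow> l) F \<Longrightarrow> coeff_tendsto f p F \<Longrightarrow> coeff_tendsto (\<lambda>v. smult (c v) (f v)) (smult l p) F"
  by (auto simp: coeff_tendsto_def intro!: tendsto_intros)

lemma coeff_tendsto_mult:
  "coeff_tendsto f p F \<Longrightarrow> coeff_tendsto g r F \<Longrightarrow> coeff_tendsto (\<lambda>v. f v * g v) (p * r) F"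
  by (auto simp: coeff_tendsto_def coeff_mult intro!: tendsto_intros)

lemma coeff_tendsto_sum:
  "(\<And>i. i \<in> I \<Longrightarrow> coeff_tendsto (f i) (p i) F) \<Longrightarrow>
    coeff_tendsto (\<lambda>v. \<Sum>i\<in>I. f i v) (\<Sum>i\<in>I. p i) F"
  by (induction I rule: infinite_finite_induct) (auto intro: coeff_tendsto_const coeff_tendsto_add)

lemma coeff_tendsto_prod:
  "(\<And>i. i \<in> I \<Longrightarrow> coeff_tendsto (f i) (p i) F) \<Longrightarrow>
    coeff_tendsto (\<lambda>v. \<Prod>i\<in>I. f i v) (\<Prod>i\<in>I. p i) F"
  by (induction I rule: infinite_finite_induct) (auto intro: coeff_tendsto_const coeff_tendsto_mult)

lemma coeff_tendsto_linear:
  "(f0 \<longlongrightarrow> a0) F \<Longrightarrow> (f1 \<longlongrightarrow> a1) F \<Longrightarrow> coeff_tendsto (\<lambda>v. [:f0 v, f1 v:]) [:a0, a1:] F"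
  by (auto simp: coeff_tendsto_def coeff_pCons split: nat.split)

lemma coeff_tendsto_cong:
  assumes "\<forall>\<^sub>F v in F. f v = g v" "coeff_tendsto g p F"
  shows "coeff_tendsto f p F"
  unfolding coeff_tendsto_def
proof
  fix k
  have "\<forall>\<^sub>F v in F. coeff (g v) k = coeff (f v) k" using assms(1) by eventually_elim simp
  thus "((\<lambda>v. coeff (f v) k) \<longlongrightarrow> coeff p k) F"
    using assms(2) by (auto simp: coeff_tendsto_def intro: Lim_transform_eventually)
qed

text \<open>Being a combination of polynomials of pairwise distinct degrees is a closed condition. The
  combination is read off from the top down: the coefficient of the member of largest degree \<open>j\<close> is
  a quotient of \<open>j\<close>-th coefficients, which converges because the limiting denominator does not
  vanish; subtracting that term leaves a combination of the remaining members.\<close>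

lemma lincomb_limit:
  fixes F :: "'v filter"
  assumes "finite J" "F \<noteq> bot"
    and "\<And>j. j \<in> J \<Longrightarrow> \<forall>\<^sub>F v in F. degree (g v j) \<le> j"
    and "\<And>j. j \<in> J \<Longrightarrow> coeff_tendsto (\<lambda>v. g v j) (G j) F"
    and "\<And>j. j \<in> J \<Longrightarrow> coeff (G j) j \<noteq> 0"
    and "coeff_tendsto f p F"
    and "\<forall>\<^sub>F v in F. f v \<in> lincomb J (g v)"
  shows "p \<in> lincomb J G"
  using assms(1,3-)
proof (induction J arbitrary: f p rule: finite_linorder_max_induct)
  case empty
  hence "\<forall>\<^sub>F v in F. f v = 0" by (simp add: lincomb_def)
  hence "coeff_tendsto (\<lambda>_. 0) p F"
    by (intro coeff_tendsto_cong[OF _ empty(4)]) (auto elim: eventually_mono)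
  hence "coeff p k = 0" for k
    using \<open>F \<noteq> bot\<close> by (simp add: coeff_tendsto_def tendsto_const_iff)
  hence "p = 0" by (simp add: poly_eq_iff)
  thus ?case by (simp add: lincomb_def)
next
  case (insert j J)
  \<comment> \<open>the coefficient of \<open>g v j\<close> in \<open>f v\<close>, recovered without knowing the combination\<close>
  define c where "c v = coeff (f v) j / coeff (g v j) j" for v
  define l where "l = coeff p j / coeff (G j) j"
  have nz: "coeff (G j) j \<noteq> 0" by (rule insert) simp
  have lim_g: "((\<lambda>v. coeff (g v j) j) \<longlongrightarrow> coeff (G j) j) F"
    using insert.prems(2)[of j] by (simp add: coeff_tendsto_def)
  have cl: "(c \<longlongrightarrow> l) F"
    unfolding c_def l_def
    using insert.prems(4) nz lim_g by (auto simp: coeff_tendsto_def intro!: tendsto_divide)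
  have ev_nz: "\<forall>\<^sub>F v in F. coeff (g v j) j \<noteq> 0"
    by (rule tendsto_imp_eventually_ne[OF lim_g nz])
  have ev_deg: "\<forall>\<^sub>F v in F. \<forall>i\<in>J. degree (g v i) \<le> i"
    using insert.prems(1) insert.hyps(1) by (intro eventually_ball_finite) auto
  have "p + smult (- l) (G j) \<in> lincomb J G"
  proof (rule insert.IH)
    show "coeff_tendsto (\<lambda>v. f v + smult (- c v) (g v j)) (p + smult (- l) (G j)) F"
      using insert.prems(2,4) by (intro coeff_tendsto_add coeff_tendsto_smult tendsto_minus cl) auto
    show "\<forall>\<^sub>F v in F. f v + smult (- c v) (g v j) \<in> lincomb J (g v)"
      using insert.prems(5) ev_nz ev_deg
    proof eventually_elim
      case (elim v)
      from elim(1) obtain e where e: "f v = (\<Sum>m\<in>insert j J. smult (e m) (g v m))"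
        by (auto simp: lincomb_def)
      have jJ: "j \<notin> J" using insert.hyps(2) by auto
      have "(\<Sum>m\<in>J. e m * coeff (g v m) j) = 0"
      proof (rule sum.neutral, rule ballI)
        fix m assume "m \<in> J"
        hence "degree (g v m) < j" using elim(3) insert.hyps(2) by fastforce
        thus "e m * coeff (g v m) j = 0" by (simp add: coeff_eq_0)
      qed
      hence "coeff (f v) j = e j * coeff (g v j) j"
        unfolding e using insert.hyps(1) jJ by (simp add: coeff_sum)
      hence "c v = e j" unfolding c_def using elim(2) by simp
      hence "f v + smult (- c v) (g v j) = (\<Sum>m\<in>J. smult (e m) (g v m))"
        unfolding e using insert.hyps(1) jJ by simp
      thus ?case by (rule lincombI)
    qed
  qed (use insert.prems in auto)
  then obtain e where e: "p + smult (- l) (G j) = (\<Sum>m\<in>J. smult (e m) (G m))"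
    by (auto simp: lincomb_def)
  have jJ: "j \<notin> J" using insert.hyps(2) by auto
  have "p = smult l (G j) + (\<Sum>m\<in>J. smult (e m) (G m))"
    unfolding e[symmetric] by simp
  also have "\<dots> = (\<Sum>m\<in>insert j J. smult ((e(j := l)) m) (G m))"
    using insert.hyps(1) jJ by (simp, intro sum.cong) auto
  finally show ?case by (rule lincombI)
qed

section \<open>Operators that lower the degree by one\<close>

locale lowering_operator =
  fixes D :: "complex poly \<Rightarrow> complex poly"
  assumes add: "D (f + g) = D f + D g"
    and smult: "D (smult c f) = smult c (D f)"
    and degree_0: "degree f = 0 \<Longrightarrow> D f = 0"
    and degree_Suc: "degree f = Suc n \<Longrightarrow> degree (D f) = n \<and> D f \<noteq> 0"
begin

lemma zero: "D 0 = 0"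
  by (rule degree_0) simp

lemma sum: "D (\<Sum>i\<in>I. f i) = (\<Sum>i\<in>I. D (f i))"
  by (induction I rule: infinite_finite_induct) (simp_all add: zero add)

lemma degree_le: "degree f \<le> Suc n \<Longrightarrow> degree (D f) \<le> n"
  by (cases "degree f") (auto dest: degree_0 degree_Suc)

lemma coeff_tendsto_D:
  assumes "coeff_tendsto f p F" "\<forall>\<^sub>F v in F. degree (f v) \<le> n" "degree p \<le> n"
  shows "coeff_tendsto (\<lambda>v. D (f v)) (D p) F"
proof -
  have D: "D g = (\<Sum>i\<le>n. smult (coeff g i) (D (monom 1 i)))" if "degree g \<le> n" for g
  proof -
    have "D g = D (\<Sum>i\<le>n. smult (coeff g i) (monom 1 i))"
      using poly_as_sum_of_monoms'[OF that] by (simp add: smult_monom)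
    thus ?thesis by (simp add: sum smult)
  qed
  have "coeff_tendsto (\<lambda>v. \<Sum>i\<le>n. smult (coeff (f v) i) (D (monom 1 i)))
      (\<Sum>i\<le>n. smult (coeff p i) (D (monom 1 i))) F"
    using assms(1) by (intro coeff_tendsto_sum coeff_tendsto_smult coeff_tendsto_const)
      (auto simp: coeff_tendsto_def)
  hence "coeff_tendsto (\<lambda>v. \<Sum>i\<le>n. smult (coeff (f v) i) (D (monom 1 i))) (D p) F"
    using D[OF assms(3)] by simp
  thus ?thesis
    by (rule coeff_tendsto_cong[rotated]) (use assms(2) in eventually_elim, simp add: D)
qed

text \<open>The relation of the theorem, written with the index shifted by two so that \<open>D (D (P (j + 2)))\<close>
  has degree exactly \<open>j\<close>. For \<open>n \<ge> 4\<close> these are the indices \<open>n - 2, \<dots>, n + 2\<close>; truncated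
  subtraction drops the terms of index below \<open>2\<close>, on which \<open>D\<^sup>2\<close> vanishes.\<close>

definition five_term_relation :: "(nat \<Rightarrow> complex poly) \<Rightarrow> nat \<Rightarrow> bool" where
  "five_term_relation P n \<longleftrightarrow> P n \<in> lincomb {n - 4..n} (\<lambda>j. D (D (P (j + 2))))"

lemma five_term_relation_scale:
  assumes "five_term_relation P n" "\<And>m. m \<le> n + 2 \<Longrightarrow> c m \<noteq> 0 \<and> Q m = smult (c m) (P m)"
  shows "five_term_relation Q n"
proof -
  have "smult (c n) (P n) \<in> lincomb {n - 4..n} (\<lambda>j. D (D (Q (j + 2))))"
    using assms(1) unfolding five_term_relation_def
    by (rule lincomb_scale[where d = "\<lambda>j. c (j + 2)"]) (use assms(2) in \<open>auto simp: smult\<close>)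
  thus ?thesis using assms(2)[of n] by (simp add: five_term_relation_def)
qed

lemma five_term_relation_limit:
  assumes "F \<noteq> bot"
    and lim: "\<And>m. m \<le> n + 2 \<Longrightarrow> coeff_tendsto (\<lambda>v. f v m) (P m) F"
    and le: "\<And>m. m \<le> n + 2 \<Longrightarrow> \<forall>\<^sub>F v in F. degree (f v m) \<le> m"
    and deg: "\<And>m. m \<le> n + 2 \<Longrightarrow> degree (P m) = m"
    and rel: "\<forall>\<^sub>F v in F. five_term_relation (f v) n"
  shows "five_term_relation P n"
  unfolding five_term_relation_def
proof (rule lincomb_limit[OF _ assms(1)])
  show "coeff_tendsto (\<lambda>v. f v n) (P n) F" by (rule lim) simp
  show "\<forall>\<^sub>F v in F. f v n \<in> lincomb {n - 4..n} (\<lambda>j. D (D (f v (j + 2))))"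
    using rel by (simp add: five_term_relation_def)
  fix j assume "j \<in> {n - 4..n}"
  hence j: "j + 2 \<le> n + 2" by simp
  have le1: "\<forall>\<^sub>F v in F. degree (D (f v (j + 2))) \<le> Suc j"
    using le[OF j] by eventually_elim (auto intro: degree_le)
  show "\<forall>\<^sub>F v in F. degree (D (D (f v (j + 2)))) \<le> j"
    using le1 by eventually_elim (auto intro: degree_le)
  have D1: "degree (D (P (j + 2))) = Suc j" using degree_Suc[of "P (j + 2)"] deg[OF j] by simp
  show "coeff_tendsto (\<lambda>v. D (D (f v (j + 2)))) (D (D (P (j + 2)))) F"
    using D1 deg[OF j] by (intro coeff_tendsto_D[OF _ le1] coeff_tendsto_D[OF lim[OF j] le[OF j]]) simp_all
  show "coeff (D (D (P (j + 2)))) j \<noteq> 0"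
    using degree_Suc[OF D1] leading_coeff_neq_0[of "D (D (P (j + 2)))"] by auto
qed simp

lemma five_term_relation_expand:
  assumes "five_term_relation P n" "n \<ge> 2"
  shows "\<exists>b. P n = (\<Sum>m = n - 2..n + 2. smult (b m) (D (D (P m))))"
proof -
  obtain c where c: "P n = (\<Sum>j = n - 4..n. smult (c j) (D (D (P (j + 2)))))"
    using assms(1) by (auto simp: five_term_relation_def lincomb_def)
  also have "\<dots> = (\<Sum>m\<in>(\<lambda>j. j + 2) ` {n - 4..n}. smult (c (m - 2)) (D (D (P m))))"
    by (subst sum.reindex) (auto simp: inj_on_def)
  also have "\<dots> \<in> lincomb {n - 2..n + 2} (\<lambda>m. D (D (P m)))"
    by (rule lincomb_mono[where I = "(\<lambda>j. j + 2) ` {n - 4..n}", OF lincombI[where c = "\<lambda>m. c (m - 2)"]]) auto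
  finally show ?thesis by (auto simp: lincomb_def)
qed

end

text \<open>The degree drop needs to be known only on one basis with a member in every degree.\<close>

lemma lowering_operatorI:
  fixes D :: "complex poly \<Rightarrow> complex poly" and b :: "nat \<Rightarrow> complex poly"
  assumes add: "\<And>f g. D (f + g) = D f + D g" and smult: "\<And>c f. D (smult c f) = smult c (D f)"
    and b: "\<And>n. degree (b n) = n" "b 0 \<noteq> 0" "D (b 0) = 0"
    and Db: "\<And>n. degree (D (b (Suc n))) = n \<and> D (b (Suc n)) \<noteq> 0"
  shows "lowering_operator D"
proof -
  have bnz: "coeff (b n) n \<noteq> 0" for n
    using b(1)[of n] b(2) leading_coeff_0_iff[of "b n"] by (cases n) fastforce+
  have *: "(n = 0 \<longrightarrow> D f = 0) \<and> (\<forall>m. n = Suc m \<longrightarrow> degree (D f) = m \<and> D f \<noteq> 0)"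
    if "degree f = n" for n f
    using that
  proof (induction n arbitrary: f rule: less_induct)
    case (less n)
    define c where "c = coeff f n / coeff (b n) n"
    define g where "g = f + smult (- c) (b n)"
    have f: "f = g + smult c (b n)" by (simp add: g_def)
    have Df: "D f = D g + smult c (D (b n))" by (subst f) (simp add: add smult)
    have gn: "coeff g n = 0" using bnz[of n] by (simp add: g_def c_def)
    have gle: "degree g \<le> n"
      unfolding g_def using less.prems b(1)[of n] by (intro degree_add_le) (auto intro: order.trans[OF degree_smult_le])
    show ?case
    proof (cases n)
      case 0
      hence "g = 0" using gle gn by (metis le_zero_eq leading_coeff_0_iff)
      thus ?thesis using Df 0 b(3) smult[of 0 0] by simp
    next
      case (Suc m)
      have fn: "coeff f n \<noteq> 0" using less.prems Suc leading_coeff_0_iff[of f] by force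
      have glt: "degree g < n"
        using gle gn Suc by (metis le_neq_implies_less leading_coeff_0_iff degree_0 zero_less_Suc)
      have Dg: "D g = 0 \<or> degree (D g) < m"
        using less.IH[OF glt refl] glt Suc by (cases "degree g") auto
      have Db': "degree (D (b n)) = m" "coeff (D (b n)) m \<noteq> 0"
        using Db[of m] Suc leading_coeff_neq_0[of "D (b n)"] by auto
      have "coeff (D f) m = c * coeff (D (b n)) m" using Dg unfolding Df by (auto simp: coeff_eq_0)
      hence nz: "coeff (D f) m \<noteq> 0" using fn bnz[of n] Db' by (simp add: c_def)
      have "degree (D f) \<le> m"
        unfolding Df using Dg Db'(1) by (intro degree_add_le) (auto intro: order.trans[OF degree_smult_le])
      thus ?thesis using nz Suc le_degree[OF nz] by auto
    qed
  qed
  show ?thesis by unfold_locales (use add smult * in auto)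
qed

section \<open>Truncated hypergeometric sums\<close>

definition hyper_sum ::
    "nat \<Rightarrow> (nat \<Rightarrow> complex) \<Rightarrow> (nat \<Rightarrow> complex) \<Rightarrow> (nat \<Rightarrow> complex) \<Rightarrow> (nat \<Rightarrow> complex)
      \<Rightarrow> (nat \<Rightarrow> complex poly) \<Rightarrow> complex poly" where
  "hyper_sum n w A B E \<phi> = (\<Sum>k\<le>n. smult (w k * (\<Prod>j<k. A j * B j / E j)) (\<phi> k))"

lemma prod_shift: "f 0 * (\<Prod>j<k. f (Suc j)) = (\<Prod>j<k. f j) * (f k :: complex)"
  by (simp flip: prod.lessThan_Suc_shift)

text \<open>Every shift of a single parameter is an instance of this contiguous relation. The sequence \<open>U\<close> collects the denominator factors
  that contain the parameter being shifted, \<open>V\<close> the others; \<open>\<psi>\<close> is the basis for the shifted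
  parameter. After re-expanding \<open>\<phi>\<close> in \<open>\<psi>\<close>, the \<open>k\<close>-th coefficients of the three sums share a common
  factor, and what is left is \<open>key\<close>: a certain function of \<open>k\<close> is a combination of the
  numerator factors \<open>A k\<close> and \<open>B k\<close>, i.e. of two linear functions of \<open>k\<close> (or of \<open>q\<^sup>k\<close>). The factor
  \<open>B\<close> is the one which makes the series terminate; advancing it lowers the degree by one.\<close>

lemma hyper_sum_contiguous:
  assumes trunc: "B (Suc m) = 0" and nz: "A 0 \<noteq> 0" "B 0 \<noteq> 0" "\<And>j. U j \<noteq> 0" "\<And>j. V j \<noteq> 0"
    and \<phi>: "\<And>k. \<phi> k = smult (s k) (\<psi> k) + smult (t k) (\<psi> (k - 1))" "t 0 = 0"
    and key: "\<And>k. s k * U k * V k * w k + A k * B k * t (Suc k) * w (Suc k)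
                = (\<alpha> * A k + \<beta> * B k) * V k * w k"
  shows "hyper_sum (Suc m) w A B (\<lambda>j. U j * V j) \<phi> =
      smult (\<alpha> * A 0 / U 0) (hyper_sum (Suc m) w (\<lambda>j. A (Suc j)) B (\<lambda>j. U (Suc j) * V j) \<psi>) +
      smult (\<beta> * B 0 / U 0) (hyper_sum m w A (\<lambda>j. B (Suc j)) (\<lambda>j. U (Suc j) * V j) \<psi>)"
proof -
  define p where "p k = (\<Prod>j<k. A j * B j / (U j * V j))" for k
  define p1 where "p1 k = (\<Prod>j<k. A (Suc j) * B j / (U (Suc j) * V j))" for k
  define p2 where "p2 k = (\<Prod>j<k. A j * B (Suc j) / (U (Suc j) * V j))" for k
  have p1: "A 0 / U 0 * p1 k = p k * A k / U k" for k
    using prod_shift[of A k] prod_shift[of U k] nz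
    by (simp add: p_def p1_def prod_dividef prod.distrib) (simp add: field_simps)
  have p2: "B 0 / U 0 * p2 k = p k * B k / U k" for k
    using prod_shift[of B k] prod_shift[of U k] nz
    by (simp add: p_def p2_def prod_dividef prod.distrib) (simp add: field_simps)
  have pS: "p (Suc k) = p k * (A k * B k / (U k * V k))" for k by (simp add: p_def)
  have p2_0: "p2 (Suc m) = 0" by (simp add: p2_def trunc)
  have coeff: "w k * p k * s k + w (Suc k) * p (Suc k) * t (Suc k)
      = \<alpha> * A 0 / U 0 * (w k * p1 k) + \<beta> * B 0 / U 0 * (w k * p2 k)" for k
  proof -
    have "w k * p k * s k + w (Suc k) * p (Suc k) * t (Suc k)
        = p k / (U k * V k) * (s k * U k * V k * w k + A k * B k * t (Suc k) * w (Suc k))"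
      unfolding pS using nz by (simp add: field_simps)
    also have "\<dots> = \<alpha> * w k * (p k * A k / U k) + \<beta> * w k * (p k * B k / U k)"
      unfolding key using nz by (simp add: field_simps)
    also have "\<dots> = \<alpha> * A 0 / U 0 * (w k * p1 k) + \<beta> * B 0 / U 0 * (w k * p2 k)"
      unfolding p1[symmetric] p2[symmetric] by (simp add: mult_ac)
    finally show ?thesis .
  qed
  have "hyper_sum (Suc m) w A B (\<lambda>j. U j * V j) \<phi>
      = (\<Sum>k\<le>Suc m. smult (w k * p k * s k) (\<psi> k)) + (\<Sum>k\<le>Suc m. smult (w k * p k * t k) (\<psi> (k - 1)))"
    unfolding hyper_sum_def p_def[symmetric] sum.distrib[symmetric]
    by (intro sum.cong refl) (simp add: \<phi>(1) smult_add_right)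
  also have "(\<Sum>k\<le>Suc m. smult (w k * p k * t k) (\<psi> (k - 1)))
      = (\<Sum>k\<le>m. smult (w (Suc k) * p (Suc k) * t (Suc k)) (\<psi> k))"
    by (subst sum.atMost_Suc_shift) (simp add: \<phi>(2))
  also have "\<dots> = (\<Sum>k\<le>Suc m. smult (w (Suc k) * p (Suc k) * t (Suc k)) (\<psi> k))"
    by (simp add: pS trunc)
  also have "(\<Sum>k\<le>Suc m. smult (w k * p k * s k) (\<psi> k)) + \<dots>
      = (\<Sum>k\<le>Suc m. smult (\<alpha> * A 0 / U 0) (smult (w k * p1 k) (\<psi> k)) +
           smult (\<beta> * B 0 / U 0) (smult (w k * p2 k) (\<psi> k)))"
    unfolding sum.distrib[symmetric] smult_add_left[symmetric] coeff by (simp add: smult_add_left)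
  also have "\<dots> = smult (\<alpha> * A 0 / U 0) (\<Sum>k\<le>Suc m. smult (w k * p1 k) (\<psi> k)) +
      smult (\<beta> * B 0 / U 0) (\<Sum>k\<le>Suc m. smult (w k * p2 k) (\<psi> k))"
    by (simp only: sum.distrib smult_sum_right)
  also have "(\<Sum>k\<le>Suc m. smult (w k * p2 k) (\<psi> k)) = (\<Sum>k\<le>m. smult (w k * p2 k) (\<psi> k))"
    by (simp add: p2_0)
  finally show ?thesis by (simp only: hyper_sum_def p1_def p2_def)
qed

text \<open>The hypothesis on \<open>w\<close> and \<open>\<kappa>\<close> says that the weights \<open>1 / k!\<close> or \<open>q\<^sup>k / (q;q)\<^sub>k\<close> absorb the
  factor which \<open>D\<close> produces, so that \<open>D\<close> merely advances every factor sequence by one step.\<close>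

lemma (in lowering_operator) hyper_sum_D:
  assumes "D (\<phi> 0) = 0" "\<And>k. D (\<phi> (Suc k)) = smult (\<kappa> k) (\<psi> k)"
    "\<And>k. w (Suc k) * \<kappa> k = \<gamma> * w k"
  shows "D (hyper_sum (Suc n) w A B E \<phi>) = smult (\<gamma> * (A 0 * B 0 / E 0))
    (hyper_sum n w (\<lambda>j. A (Suc j)) (\<lambda>j. B (Suc j)) (\<lambda>j. E (Suc j)) \<psi>)"
proof -
  have "D (hyper_sum (Suc n) w A B E \<phi>)
      = (\<Sum>k\<le>n. smult (w (Suc k) * \<kappa> k * (\<Prod>j<Suc k. A j * B j / E j)) (\<psi> k))"
    unfolding hyper_sum_def sum smult
    by (subst sum.atMost_Suc_shift) (simp add: assms(1,2) mult_ac)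
  also have "\<dots> = (\<Sum>k\<le>n. smult (\<gamma> * (A 0 * B 0 / E 0))
      (smult (w k * (\<Prod>j<k. A (Suc j) * B (Suc j) / E (Suc j))) (\<psi> k)))"
    unfolding assms(3) prod.lessThan_Suc_shift by (simp add: mult_ac)
  finally show ?thesis by (simp only: hyper_sum_def smult_sum_right)
qed

lemma coeff_tendsto_hyper_sum:
  assumes "\<And>j. ((\<lambda>v. A v j) \<longlongrightarrow> A' j) F" "\<And>j. ((\<lambda>v. E v j) \<longlongrightarrow> E' j) F"
    "\<And>j. j < n \<Longrightarrow> E' j \<noteq> 0" "\<And>k. coeff_tendsto (\<lambda>v. \<phi> v k) (\<phi>' k) F"
  shows "coeff_tendsto (\<lambda>v. hyper_sum n w (A v) B (E v) (\<phi> v)) (hyper_sum n w A' B E' \<phi>') F"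
  unfolding hyper_sum_def
  by (intro coeff_tendsto_sum coeff_tendsto_smult tendsto_mult tendsto_const tendsto_prod tendsto_divide assms) auto

lemma degree_hyper_sum_le: "(\<And>k. degree (\<phi> k) \<le> k) \<Longrightarrow> degree (hyper_sum n w A B E \<phi>) \<le> n"
  unfolding hyper_sum_def
  by (intro degree_sum_le) (auto intro!: order.trans[OF degree_smult_le] intro: order.trans)

lemma linear_function_decomposition:
  fixes p0 :: complex
  assumes "p0 * q1 - p1 * q0 \<noteq> 0"
  obtains \<alpha> \<beta> where "\<And>z. \<alpha> * (p0 + p1 * z) + \<beta> * (q0 + q1 * z) = u0 + u1 * z"
proof
  fix z
  let ?d = "p0 * q1 - p1 * q0"
  have "(u0 * q1 - u1 * q0) * (p0 + p1 * z) + (p0 * u1 - p1 * u0) * (q0 + q1 * z) = ?d * (u0 + u1 * z)"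
    by (simp add: algebra_simps)
  thus "(u0 * q1 - u1 * q0) / ?d * (p0 + p1 * z) + (p0 * u1 - p1 * u0) / ?d * (q0 + q1 * z) = u0 + u1 * z"
    using assms by (simp add: divide_simps)
qed

section \<open>Divided differences on a lattice\<close>

locale difference_lattice =
  fixes x :: "complex \<Rightarrow> complex"
  assumes is_ddiff: "is_ddiff x f (ddiff x f)"
    and infinite_lattice: "infinite (x ` {s. x (s + 1/2) \<noteq> x (s - 1/2)})"
begin

lemma ddiff_eqI:
  assumes "is_ddiff x f g"
  shows "ddiff x f = g"
  by (rule poly_eq_on_infinite[OF infinite_lattice])
    (use assms is_ddiff[of f] in \<open>auto simp: is_ddiff_def\<close>)

lemma ddiff_add: "ddiff x (f + g) = ddiff x f + ddiff x g"
  by (rule ddiff_eqI) (use is_ddiff[of f] is_ddiff[of g] in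
    \<open>auto simp: is_ddiff_def add_divide_distrib[symmetric]\<close>)

lemma ddiff_smult: "ddiff x (smult c f) = smult c (ddiff x f)"
  by (rule ddiff_eqI) (use is_ddiff[of f] in
    \<open>auto simp: is_ddiff_def right_diff_distrib[symmetric]\<close>)

lemma ddiff_1: "ddiff x 1 = 0"
  by (rule ddiff_eqI) (simp add: is_ddiff_def)

lemma lowering_operator_ddiff:
  assumes "b 0 = 1" "\<And>n. degree (b n) = n"
    "\<And>n. degree (ddiff x (b (Suc n))) = n \<and> ddiff x (b (Suc n)) \<noteq> 0"
  shows "lowering_operator (ddiff x)"
  by (rule lowering_operatorI[where b = b]) (use assms in \<open>auto simp: ddiff_add ddiff_smult ddiff_1\<close>)

end

lemma square_lattice_difference_lattice: "difference_lattice square_lattice"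
proof
  have "- {0} \<subseteq> square_lattice ` {s. square_lattice (s + 1/2) \<noteq> square_lattice (s - 1/2)}"
  proof
    fix y :: complex assume "y \<in> - {0}"
    hence "csqrt y \<noteq> 0" by simp
    hence "square_lattice (csqrt y + 1/2) \<noteq> square_lattice (csqrt y - 1/2)"
      by (simp add: square_lattice_def power2_eq_square algebra_simps)
    moreover have "y = square_lattice (csqrt y)" by (simp add: square_lattice_def)
    ultimately show "y \<in> square_lattice ` {s. square_lattice (s + 1/2) \<noteq> square_lattice (s - 1/2)}"
      by blast
  qed
  moreover have "infinite (- {0} :: complex set)"
    by (simp add: Compl_eq_Diff_UNIV infinite_UNIV_char_0)
  ultimately show "infinite (square_lattice ` {s. square_lattice (s + 1/2) \<noteq> square_lattice (s - 1/2)})"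
    using finite_subset by blast
qed (rule square_lattice_ddiff)

text \<open>The basis \<open>(a - z)\<^sub>k (a + z)\<^sub>k\<close> of the Wilson polynomials, as a polynomial in \<open>z\<^sup>2\<close>.\<close>

definition square_factorial :: "complex \<Rightarrow> nat \<Rightarrow> complex poly" where
  "square_factorial a k = (\<Prod>j<k. [:(a + of_nat j)\<^sup>2, - 1:])"

lemma poly_square_factorial:
  "poly (square_factorial a k) (z\<^sup>2) = pochhammer (a - z) k * pochhammer (a + z) k"
  using poly_prod_neg_squares[of a k "- \<i> * z"]
  by (simp add: square_factorial_def power_mult_distrib)

lemma degree_square_factorial: "degree (square_factorial a k) = k"
  unfolding square_factorial_def by (subst degree_prod_eq_sum_degree) auto

interpretation square: difference_lattice square_lattice
  by (rule square_lattice_difference_lattice)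

text \<open>The two shifted values share \<open>k\<close> of their \<open>k + 1\<close> factors in each of \<open>a - z\<close> and \<open>a + z\<close>;
  pulling these out leaves a difference of two quadratics.\<close>

lemma ddiff_square_factorial:
  "ddiff square_lattice (square_factorial a (Suc k)) =
    smult (- of_nat (Suc k)) (square_factorial (a + 1/2) k)"
proof (rule square.ddiff_eqI, unfold is_ddiff_def, intro allI impI)
  fix z :: complex
  assume "square_lattice (z + 1/2) \<noteq> square_lattice (z - 1/2)"
  hence z: "z \<noteq> 0" by (auto simp: square_lattice_def power2_eq_square)
  have z2: "square_lattice (z + 1/2) - square_lattice (z - 1/2) = 2 * z"
    by (simp add: square_lattice_def power2_eq_square algebra_simps)
  define X where "X = pochhammer (a + 1/2 - z) k"
  define Y where "Y = pochhammer (a + 1/2 + z) k"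
  have "pochhammer (a - (z + 1/2)) (Suc k) = (a - 1/2 - z) * X"
    by (simp add: pochhammer_rec X_def algebra_simps)
  moreover have "pochhammer (a + (z + 1/2)) (Suc k) = Y * (a + 1/2 + z + of_nat k)"
    by (simp add: pochhammer_Suc Y_def algebra_simps)
  moreover have "pochhammer (a + (z - 1/2)) (Suc k) = (a - 1/2 + z) * Y"
    by (simp add: pochhammer_rec Y_def algebra_simps)
  moreover have "pochhammer (a - (z - 1/2)) (Suc k) = X * (a + 1/2 - z + of_nat k)"
    by (simp add: pochhammer_Suc X_def algebra_simps)
  ultimately have "poly (square_factorial a (Suc k)) (square_lattice (z + 1/2)) -
      poly (square_factorial a (Suc k)) (square_lattice (z - 1/2))
      = (a - 1/2 - z) * X * (Y * (a + 1/2 + z + of_nat k)) -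
        X * (a + 1/2 - z + of_nat k) * ((a - 1/2 + z) * Y)"
    unfolding square_lattice_def poly_square_factorial by simp
  also have "\<dots> = - of_nat (Suc k) * (X * Y) * (2 * z)" by (simp add: algebra_simps)
  finally show "poly (smult (- of_nat (Suc k)) (square_factorial (a + 1/2) k)) (square_lattice z) =
      (poly (square_factorial a (Suc k)) (square_lattice (z + 1/2)) -
       poly (square_factorial a (Suc k)) (square_lattice (z - 1/2))) /
      (square_lattice (z + 1/2) - square_lattice (z - 1/2))"
    unfolding z2 using z by (simp add: square_lattice_def poly_square_factorial X_def Y_def)
qed

lemma square_lattice_lowering_operator: "lowering_operator (ddiff square_lattice)"
proof (rule square.lowering_operator_ddiff[where b = "square_factorial 0"])
  fix n
  have "square_factorial a n \<noteq> 0" for a by (simp add: square_factorial_def)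
  thus "degree (ddiff square_lattice (square_factorial 0 (Suc n))) = n \<and>
      ddiff square_lattice (square_factorial 0 (Suc n)) \<noteq> 0"
    unfolding ddiff_square_factorial by (simp add: degree_square_factorial del: of_nat_Suc)
qed (simp_all add: degree_square_factorial, simp add: square_factorial_def)

interpretation square: lowering_operator "ddiff square_lattice"
  by (rule square_lattice_lowering_operator)

text \<open>The basis \<open>(a w; q)\<^sub>k (a / w; q)\<^sub>k\<close> of the Askey--Wilson polynomials, as a polynomial in
  \<open>(w + 1 / w) / 2\<close>.\<close>

definition q_factorial :: "complex \<Rightarrow> complex \<Rightarrow> nat \<Rightarrow> complex poly" where
  "q_factorial q a k = (\<Prod>j<k. [:1 + (a * q ^ j)\<^sup>2, - 2 * a * q ^ j:])"

lemma poly_q_factorial: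
  assumes "w \<noteq> 0"
  shows "poly (q_factorial q a k) ((inverse w + w) / 2) = qpochhammer (a * w) q k * qpochhammer (a / w) q k"
  unfolding q_factorial_def qpochhammer_def poly_prod prod.distrib[symmetric]
  by (intro prod.cong refl) (use assms in \<open>simp add: field_simps power2_eq_square\<close>)

lemma degree_q_factorial:
  assumes "q \<noteq> 0" "a \<noteq> 0"
  shows "degree (q_factorial q a k) = k"
  unfolding q_factorial_def using assms by (subst degree_prod_eq_sum_degree) auto

lemma degree_q_factorial_le: "degree (q_factorial q a k) \<le> k"
proof -
  have "degree (q_factorial q a k) \<le> sum (degree \<circ> (\<lambda>j. [:1 + (a * q ^ j)\<^sup>2, - 2 * a * q ^ j:])) {..<k}"
    unfolding q_factorial_def by (rule degree_prod_sum_le) simp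
  also have "\<dots> \<le> (\<Sum>j<k. 1)" by (intro sum_mono) simp
  finally show ?thesis by simp
qed

lemma qpochhammer_Suc: "qpochhammer a q (Suc k) = qpochhammer a q k * (1 - a * q ^ k)"
  by (simp add: qpochhammer_def)

lemma qpochhammer_rec: "qpochhammer a q (Suc k) = (1 - a) * qpochhammer (a * q) q k"
  by (simp add: qpochhammer_def prod.lessThan_Suc_shift mult_ac del: prod.lessThan_Suc)

locale q_lattice_base =
  fixes q0 :: real and q :: complex
  assumes q0: "q0 > 0" "q0 \<noteq> 1" and q_def: "q = complex_of_real q0"
begin

lemma q_nz: "q \<noteq> 0"
  using q0 by (simp add: q_def)

lemma q_power_ne_1: "q ^ Suc n \<noteq> 1"
proof
  assume "q ^ Suc n = 1"
  hence "complex_of_real (q0 ^ Suc n) = of_real 1" by (simp add: q_def)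
  hence "q0 ^ Suc n = 1 ^ Suc n" by (simp only: of_real_eq_iff power_one)
  hence "q0 = 1" using q0 by (intro power_eq_imp_eq_base[of q0 "Suc n" 1]) auto
  thus False using q0 by simp
qed

lemma q_ne_1: "q \<noteq> 1"
  using q_power_ne_1[of 0] by simp

definition r :: complex where "r = q powr (1/2)"

lemma r_square: "r * r = q"
  using q_nz by (simp add: r_def flip: powr_add)

lemma r_nz: "r \<noteq> 0"
  using r_square q_nz by auto

lemma q_lattice_at: "q_lattice q s = (inverse (q powr s) + q powr s) / 2"
  by (simp add: q_lattice_def powr_minus)

lemma q_lattice_plus: "q_lattice q (s + 1/2) = (inverse (q powr s * r) + q powr s * r) / 2"
  unfolding q_lattice_at r_def by (simp add: powr_add)

lemma q_lattice_minus: "q_lattice q (s - 1/2) = (inverse (q powr s / r) + q powr s / r) / 2"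
  unfolding q_lattice_at r_def by (simp add: powr_diff)

lemma q_powr_surj: "w \<noteq> 0 \<Longrightarrow> \<exists>s. q powr s = w"
  using q0 q_nz by (intro exI[of _ "Ln w / Ln q"]) (simp add: powr_def q_def Ln_of_real)

lemma q_lattice_gap:
  "q_lattice q (s + 1/2) - q_lattice q (s - 1/2) = (r - inverse r) * (q powr s - inverse (q powr s)) / 2"
  unfolding q_lattice_plus q_lattice_minus using q_nz r_nz by (simp add: field_simps)

sublocale difference_lattice "q_lattice q"
proof
  show "is_ddiff (q_lattice q) f (ddiff (q_lattice q) f)" for f
    using q_lattice_ddiff[OF q0] by (simp add: q_def)
  have "- {1, -1} \<subseteq> q_lattice q ` {s. q_lattice q (s + 1/2) \<noteq> q_lattice q (s - 1/2)}"
  proof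
    fix y :: complex assume y: "y \<in> - {1, -1}"
    \<comment> \<open>a root of \<open>w\<^sup>2 - 2 y w + 1\<close>, so that \<open>(w + 1 / w) / 2 = y\<close>\<close>
    define w where "w = y + csqrt (y\<^sup>2 - 1)"
    have "(w - y)\<^sup>2 = y\<^sup>2 - 1" by (simp add: w_def)
    hence w: "w * w + 1 = 2 * y * w" by (simp add: power2_eq_square algebra_simps)
    have w0: "w \<noteq> 0" using w by auto
    obtain s where s: "q powr s = w" using q_powr_surj[OF w0] by auto
    have "y = q_lattice q s" using w w0 by (simp add: q_lattice_at s field_simps)
    moreover have "w \<noteq> inverse w"
    proof
      assume "w = inverse w"
      hence ww: "w * w = 1" using w0 by (metis right_inverse)
      have "1 + 1 = 2 * y * w" using w unfolding ww .
      hence yw: "y * w = 1" by (simp add: mult.assoc)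
      have "y = y * (w * w)" unfolding ww by simp
      also have "\<dots> = w" using yw by (simp add: mult.assoc[symmetric] del: mult_cancel_left1)
      finally have "y = w" .
      moreover have "w = 1 \<or> w = - 1" using ww by (simp add: square_eq_1_iff)
      ultimately
      show False using y by blast
    qed
    moreover have "r \<noteq> inverse r"
      using r_square r_nz q_ne_1 by (metis right_inverse)
    ultimately have "q_lattice q (s + 1/2) - q_lattice q (s - 1/2) \<noteq> 0" "y = q_lattice q s"
      by (simp_all add: q_lattice_gap s)
    thus "y \<in> q_lattice q ` {s. q_lattice q (s + 1/2) \<noteq> q_lattice q (s - 1/2)}" by auto
  qed
  moreover have "infinite (- {1, -1} :: complex set)"
    by (simp add: Compl_eq_Diff_UNIV infinite_UNIV_char_0)
  ultimately show "infinite (q_lattice q ` {s. q_lattice q (s + 1/2) \<noteq> q_lattice q (s - 1/2)})"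
    using finite_subset by blast
qed

text \<open>As on the square lattice, all but two of the factors cancel. With \<open>w = q\<^sup>s\<close> and \<open>r\<^sup>2 = q\<close> the
  shifts of \<open>s\<close> by \<open>\<plusminus>1/2\<close> are multiplications of \<open>w\<close> by \<open>r\<^sup>\<plusminus>\<^sup>1\<close>.\<close>

lemma ddiff_q_factorial:
  "ddiff (q_lattice q) (q_factorial q a (Suc k)) =
    smult (2 * a * (1 - q ^ Suc k) / (q - 1)) (q_factorial q (a * r) k)"
proof (rule ddiff_eqI, unfold is_ddiff_def, intro allI impI)
  fix s assume ne: "q_lattice q (s + 1/2) \<noteq> q_lattice q (s - 1/2)"
  define w where "w = q powr s"
  have w: "w \<noteq> 0" "w * r \<noteq> 0" "w / r \<noteq> 0" using q_nz r_nz by (simp_all add: w_def)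
  define X where "X = qpochhammer (a * w * r) q k"
  define Y where "Y = qpochhammer (a * r / w) q k"
  have shift: "a / (w * r) * q = a * r / w" "a * (w / r) * q = a * w * r"
  proof -
    have "a / (w * r) * (r * r) = a * r / w" "a * (w / r) * (r * r) = a * w * r"
      using w r_nz by (simp_all add: field_simps)
    thus "a / (w * r) * q = a * r / w" "a * (w / r) * q = a * w * r" by (simp_all only: r_square)
  qed
  have e1: "qpochhammer (a * (w * r)) q (Suc k) = X * (1 - a * w * r * q ^ k)"
    by (simp add: qpochhammer_Suc X_def mult_ac)
  have e2: "qpochhammer (a / (w * r)) q (Suc k) = (1 - a / (w * r)) * Y"
    unfolding qpochhammer_rec Y_def shift by simp
  have e3: "qpochhammer (a * (w / r)) q (Suc k) = (1 - a * w / r) * X"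
    unfolding qpochhammer_rec X_def shift by simp
  have e4: "qpochhammer (a / (w / r)) q (Suc k) = Y * (1 - a * r / w * q ^ k)"
    by (simp add: qpochhammer_Suc Y_def mult_ac)
  have expand: "X * P * (R * Y) - S * X * (Y * T) = X * Y * (P * R - S * T)" for P R S T
    by (simp add: algebra_simps)
  have "poly (q_factorial q a (Suc k)) (q_lattice q (s + 1/2)) -
      poly (q_factorial q a (Suc k)) (q_lattice q (s - 1/2))
      = X * Y * ((1 - a * w * r * q ^ k) * (1 - a / (w * r)) - (1 - a * w / r) * (1 - a * r / w * q ^ k))"
    unfolding q_lattice_plus q_lattice_minus w_def[symmetric]
      poly_q_factorial[OF w(2)] poly_q_factorial[OF w(3)] e1 e2 e3 e4 by (rule expand)
  also have "(1 - a * w * r * q ^ k) * (1 - a / (w * r)) - (1 - a * w / r) * (1 - a * r / w * q ^ k)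
      = a * (1 - q ^ Suc k) / r * (w - inverse w)"
  proof -
    have *: "(1 - a * w * R * Q) * (1 - a / (w * R)) - (1 - a * w / R) * (1 - a * R / w * Q)
        = a * (1 - R * R * Q) / R * (w - inverse w)" if "R \<noteq> 0" for R Q
      using that w(1) by (simp add: field_simps)
    show ?thesis using *[OF r_nz, of "q ^ k"] by (simp add: r_square)
  qed
  also have "\<dots> = 2 * a * (1 - q ^ Suc k) / (q - 1) * (q_lattice q (s + 1/2) - q_lattice q (s - 1/2))"
  proof -
    have "(r - inverse r) * r = q - 1" using r_nz by (simp add: algebra_simps r_square)
    hence "(r - inverse r) / (q - 1) = 1 / r" using r_nz q_ne_1 by (simp add: divide_simps)
    hence "a * (1 - q ^ Suc k) / r * (w - inverse w)
        = a * (1 - q ^ Suc k) * ((r - inverse r) / (q - 1)) * (w - inverse w)"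
      by simp
    moreover have "A * (M / N) * Z = 2 * A / N * (M * Z / 2)" for A M N Z :: complex
      by simp
    ultimately show ?thesis by (simp only: q_lattice_gap w_def[symmetric] mult.assoc[of 2 a])
  qed
  finally show "poly (smult (2 * a * (1 - q ^ Suc k) / (q - 1)) (q_factorial q (a * r) k)) (q_lattice q s) =
      (poly (q_factorial q a (Suc k)) (q_lattice q (s + 1/2)) -
       poly (q_factorial q a (Suc k)) (q_lattice q (s - 1/2))) /
      (q_lattice q (s + 1/2) - q_lattice q (s - 1/2))"
    using ne poly_q_factorial[OF w(1), of q "a * r" k]
    by (simp add: q_lattice_at[of s] w_def[symmetric] X_def Y_def mult_ac)
qed

sublocale lowering_operator "ddiff (q_lattice q)"
proof (rule lowering_operator_ddiff[where b = "q_factorial q 1"])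
  fix n
  have "degree (q_factorial q r n) = n" "q_factorial q r n \<noteq> 0"
    using degree_q_factorial[OF q_nz r_nz] q_nz r_nz by (simp_all add: q_factorial_def)
  thus "degree (ddiff (q_lattice q) (q_factorial q 1 (Suc n))) = n \<and>
      ddiff (q_lattice q) (q_factorial q 1 (Suc n)) \<noteq> 0"
    unfolding ddiff_q_factorial using q_power_ne_1[of n] q_ne_1 by simp
  show "degree (q_factorial q 1 n) = n" by (rule degree_q_factorial[OF q_nz]) simp
qed (simp add: q_factorial_def)

end

section \<open>Wilson and continuous dual Hahn polynomials at generic parameters\<close>

text \<open>Wilson and continuous dual Hahn polynomials in one family: the parameter \<open>d\<close> is made homogeneous,
  each factor \<open>d + y\<close> becoming \<open>\<delta> + \<epsilon> y\<close>. Then \<open>(\<epsilon>, \<delta>) = (1, d)\<close> is the \<open>\<^sub>4F\<^sub>3\<close> of the Wilson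
  polynomials, and for \<open>(\<epsilon>, \<delta>) = (0, 1)\<close>, which is \<open>d = \<infinity>\<close>, the additional factors are all \<open>1\<close> and the
  \<open>\<^sub>3F\<^sub>2\<close> of the continuous dual Hahn polynomials remains. Increasing \<open>d\<close> by \<open>1\<close> is \<open>\<delta> \<mapsto> \<delta> + \<epsilon>\<close>.\<close>

definition wilson_sum :: "complex \<Rightarrow> nat \<Rightarrow> complex \<Rightarrow> complex \<Rightarrow> complex \<Rightarrow> complex \<Rightarrow> complex poly" where
  "wilson_sum \<epsilon> n a b c \<delta> =
    hyper_sum n (\<lambda>k. 1 / fact k) (\<lambda>j. \<delta> + \<epsilon> * (of_nat n + a + b + c - 1 + of_nat j)) (\<lambda>j. of_nat j - of_nat n)
      (\<lambda>j. (a + b + of_nat j) * (a + c + of_nat j) * (\<delta> + \<epsilon> * (a + of_nat j))) (square_factorial a)"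

text \<open>The first three conditions keep the denominators away from \<open>0\<close>. The last one makes the two
  numerator factors linearly independent as functions of \<open>k\<close>, and the leading coefficients nonzero.
  All are asked for every \<open>i\<close>, not up to a degree, so that genericity
  survives the parameter shifts.\<close>

definition wilson_generic :: "complex \<Rightarrow> complex \<Rightarrow> complex \<Rightarrow> complex \<Rightarrow> complex \<Rightarrow> bool" where
  "wilson_generic \<epsilon> a b c \<delta> \<longleftrightarrow> (\<forall>i::nat. a + b + of_nat i \<noteq> 0 \<and> a + c + of_nat i \<noteq> 0 \<and>
      \<delta> + \<epsilon> * (a + of_nat i) \<noteq> 0 \<and> \<delta> + \<epsilon> * (a + b + c + of_nat i) \<noteq> 0)"

lemma wilson_genericD:
  assumes "wilson_generic \<epsilon> a b c \<delta>"
  shows "a + b + of_nat i \<noteq> 0" "a + c + of_nat i \<noteq> 0" "\<delta> + \<epsilon> * (a + of_nat i) \<noteq> 0"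
    "\<delta> + \<epsilon> * (a + b + c + of_nat i) \<noteq> 0"
  using assms by (auto simp: wilson_generic_def)

lemma wilson_generic_shift:
  assumes "wilson_generic \<epsilon> a b c \<delta>"
  shows "wilson_generic \<epsilon> a (b + 1) c \<delta>" "wilson_generic \<epsilon> a b (c + 1) \<delta>" "wilson_generic \<epsilon> a b c (\<delta> + \<epsilon>)"
    "wilson_generic \<epsilon> (a + 1/2) (b + 1/2) (c + 1/2) (\<delta> + \<epsilon> / 2)"
proof -
  note * = wilson_genericD[OF assms]
  note S = *[of "Suc i" for i] and SS = *[of "Suc (Suc i)" for i]
  show "wilson_generic \<epsilon> a (b + 1) c \<delta>" "wilson_generic \<epsilon> a b (c + 1) \<delta>"
    "wilson_generic \<epsilon> a b c (\<delta> + \<epsilon>)"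
    unfolding wilson_generic_def using * S by (simp_all add: algebra_simps)
  have half: "a + 1/2 + (y + 1/2) + of_nat i = a + y + of_nat (Suc i)"
    "\<delta> + \<epsilon> / 2 + \<epsilon> * (a + 1/2 + of_nat i) = \<delta> + \<epsilon> * (a + of_nat (Suc i))"
    "\<delta> + \<epsilon> / 2 + \<epsilon> * (a + 1/2 + (b + 1/2) + (c + 1/2) + of_nat i)
      = \<delta> + \<epsilon> * (a + b + c + of_nat (Suc (Suc i)))" for i y
    by (simp_all add: field_simps)
  show "wilson_generic \<epsilon> (a + 1/2) (b + 1/2) (c + 1/2) (\<delta> + \<epsilon> / 2)"
    unfolding wilson_generic_def half using S SS by blast
qed

lemma wilson_sum_0: "wilson_sum \<epsilon> 0 a b c \<delta> = 1"
  by (simp add: wilson_sum_def hyper_sum_def square_factorial_def)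

text \<open>One parameter shift \<open>(a, b, c, \<delta>) \<mapsto> (a', b', c', \<delta>')\<close> that increases the sum of the parameters by \<open>1\<close>
  (by \<open>\<epsilon>\<close> in homogeneous form).
  Hypothesis \<open>key\<close> only asks that the function to be decomposed is linear in \<open>k\<close>: by genericity the two
  numerator factors span all linear functions.\<close>

lemma wilson_sum_step:
  assumes gen: "wilson_generic \<epsilon> a b c \<delta>"
    and \<phi>: "\<And>k. square_factorial a k = smult (s k) (square_factorial a' k) + smult (t k) (square_factorial a' (k - 1))"
    and t0: "t 0 = 0"
    and UV: "\<And>j. (a + b + of_nat j) * (a + c + of_nat j) * (\<delta> + \<epsilon> * (a + of_nat j)) = U j * V j"
    and UV': "\<And>j. (a' + b' + of_nat j) * (a' + c' + of_nat j) * (\<delta>' + \<epsilon> * (a' + of_nat j)) = U (Suc j) * V j"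
    and total: "\<delta>' + \<epsilon> * (a' + b' + c') = \<delta> + \<epsilon> * (a + b + c + 1)"
    and key: "\<And>n k. s k * U k + (\<delta> + \<epsilon> * (of_nat n + a + b + c + of_nat k)) * (of_nat k - of_nat (Suc n)) * t (Suc k)
        / (V k * of_nat (Suc k)) = u0 n + u1 n * of_nat k"
  shows "wilson_sum \<epsilon> n a b c \<delta> \<in> lincomb {n - 1..n} (\<lambda>m. wilson_sum \<epsilon> m a' b' c' \<delta>')"
proof (cases n)
  case 0
  thus ?thesis by (intro lincombI[where c = "\<lambda>_. 1"]) (simp add: wilson_sum_0)
next
  case (Suc m)
  define A where "A j = \<delta> + \<epsilon> * (of_nat m + a + b + c + of_nat j)" for j
  define B where "B j = (of_nat j - of_nat (Suc m) :: complex)" for j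
  have UV_nz: "U j \<noteq> 0" "V j \<noteq> 0" for j
    using UV[of j, symmetric] wilson_genericD[OF gen, of j] by auto
  have A0: "A 0 \<noteq> 0" using wilson_genericD(4)[OF gen, of m] by (simp add: A_def algebra_simps)
  \<comment> \<open>the determinant of \<open>A\<close> and \<open>B\<close> as linear functions of \<open>k\<close>\<close>
  have "(\<delta> + \<epsilon> * (of_nat m + a + b + c)) * 1 - \<epsilon> * (- of_nat (Suc m)) \<noteq> 0"
    using wilson_genericD(4)[OF gen, of "Suc (2 * m)"] by (simp add: algebra_simps)
  then obtain \<alpha> \<beta> where lin: "\<And>z. \<alpha> * (\<delta> + \<epsilon> * (of_nat m + a + b + c) + \<epsilon> * z) + \<beta> * (- of_nat (Suc m) + 1 * z) = u0 m + u1 m * z"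
    using linear_function_decomposition by blast
  have lin: "\<alpha> * A k + \<beta> * B k = u0 m + u1 m * of_nat k" for k
    using lin[of "of_nat k"] by (simp add: A_def B_def algebra_simps)
  have sum_eq: "wilson_sum \<epsilon> (Suc m) a b c \<delta> =
      hyper_sum (Suc m) (\<lambda>k. 1 / fact k) A B (\<lambda>j. U j * V j) (square_factorial a)"
    unfolding wilson_sum_def UV A_def B_def by (simp add: add_ac)
  have A1: "\<delta>' + \<epsilon> * (of_nat (Suc m) + a' + b' + c' - 1 + of_nat j) = A (Suc j)" for j
    using total by (simp add: A_def algebra_simps)
  have A2: "\<delta>' + \<epsilon> * (of_nat m + a' + b' + c' - 1 + of_nat j) = A j" for j
    using total by (simp add: A_def algebra_simps)
  have B2: "of_nat j - of_nat m = B (Suc j)" for j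
    by (simp add: B_def)
  have "wilson_sum \<epsilon> (Suc m) a b c \<delta> =
      smult (\<alpha> * A 0 / U 0) (wilson_sum \<epsilon> (Suc m) a' b' c' \<delta>') +
      smult (\<beta> * B 0 / U 0) (wilson_sum \<epsilon> m a' b' c' \<delta>')"
    unfolding sum_eq unfolding wilson_sum_def UV' A1 A2 B2 B_def[symmetric]
  proof (rule hyper_sum_contiguous[where s = s and t = t])
    fix k
    have "s k * U k * V k * (1 / fact k) + A k * B k * t (Suc k) * (1 / fact (Suc k))
        = V k / fact k * (s k * U k + A k * B k * t (Suc k) / (V k * of_nat (Suc k)))"
      using UV_nz by (simp add: field_simps del: of_nat_Suc)
    also have "\<dots> = V k / fact k * (\<alpha> * A k + \<beta> * B k)"
      using key[of k m] lin[of k] by (simp only: A_def B_def)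
    finally show "s k * U k * V k * (1 / fact k) + A k * B k * t (Suc k) * (1 / fact (Suc k))
        = (\<alpha> * A k + \<beta> * B k) * V k * (1 / fact k)"
      by (simp add: mult_ac)
  next
    have "(of_nat (Suc m) :: complex) \<noteq> 0" by (rule of_nat_neq_0)
    thus "B 0 \<noteq> 0" unfolding B_def by (simp del: of_nat_Suc)
  qed (simp_all only: A0 UV_nz \<phi>[symmetric] t0 not_False_eq_True, simp add: B_def)
  thus ?thesis unfolding Suc
    by (intro lincombI[where c = "\<lambda>k. if k = Suc m then \<alpha> * A 0 / U 0 else \<beta> * B 0 / U 0"])
      (simp add: atLeastAtMostSuc_conv)
qed

lemma wilson_sum_shift_b:
  assumes "wilson_generic \<epsilon> a b c \<delta>"
  shows "wilson_sum \<epsilon> n a b c \<delta> \<in> lincomb {n - 1..n} (\<lambda>m. wilson_sum \<epsilon> m a (b + 1) c \<delta>)"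
  by (rule wilson_sum_step[OF assms, where s = "\<lambda>_. 1" and t = "\<lambda>_. 0" and U = "\<lambda>j. a + b + of_nat j"
      and V = "\<lambda>j. (a + c + of_nat j) * (\<delta> + \<epsilon> * (a + of_nat j))" and ?u0.0 = "\<lambda>_. a + b" and ?u1.0 = "\<lambda>_. 1"])
    (simp_all add: algebra_simps)

lemma wilson_sum_shift_c:
  assumes "wilson_generic \<epsilon> a b c \<delta>"
  shows "wilson_sum \<epsilon> n a b c \<delta> \<in> lincomb {n - 1..n} (\<lambda>m. wilson_sum \<epsilon> m a b (c + 1) \<delta>)"
  by (rule wilson_sum_step[OF assms, where s = "\<lambda>_. 1" and t = "\<lambda>_. 0" and U = "\<lambda>j. a + c + of_nat j"
      and V = "\<lambda>j. (a + b + of_nat j) * (\<delta> + \<epsilon> * (a + of_nat j))" and ?u0.0 = "\<lambda>_. a + c" and ?u1.0 = "\<lambda>_. 1"])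
    (simp_all add: algebra_simps)

lemma wilson_sum_shift_d:
  assumes "wilson_generic \<epsilon> a b c \<delta>"
  shows "wilson_sum \<epsilon> n a b c \<delta> \<in> lincomb {n - 1..n} (\<lambda>m. wilson_sum \<epsilon> m a b c (\<delta> + \<epsilon>))"
  by (rule wilson_sum_step[OF assms, where s = "\<lambda>_. 1" and t = "\<lambda>_. 0" and U = "\<lambda>j. \<delta> + \<epsilon> * (a + of_nat j)"
      and V = "\<lambda>j. (a + b + of_nat j) * (a + c + of_nat j)" and ?u0.0 = "\<lambda>_. \<delta> + \<epsilon> * a" and ?u1.0 = "\<lambda>_. \<epsilon>"])
    (simp_all add: algebra_simps)

text \<open>The factor \<open>a\<^sup>2 - x\<close> and the factor \<open>(a + k)\<^sup>2 - x\<close> that would complete the basis element for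
  \<open>a + 1\<close> differ by a constant.\<close>

lemma square_factorial_shift:
  "square_factorial a k = smult 1 (square_factorial (a + 1) k) +
    smult (- of_nat k * (2 * a + of_nat k)) (square_factorial (a + 1) (k - 1))"
proof (cases k)
  case (Suc m)
  have "square_factorial a (Suc m) = [:a\<^sup>2, - 1:] * square_factorial (a + 1) m"
    unfolding square_factorial_def prod.lessThan_Suc_shift by (simp add: add_ac)
  moreover have "square_factorial (a + 1) (Suc m) = [:(a + of_nat (Suc m))\<^sup>2, - 1:] * square_factorial (a + 1) m"
    unfolding square_factorial_def by (simp add: add_ac mult.commute)
  moreover have "[:a\<^sup>2, - 1:] = [:(a + of_nat (Suc m))\<^sup>2, - 1:] + [:- of_nat (Suc m) * (2 * a + of_nat (Suc m)):]"
    by (simp add: power2_eq_square algebra_simps)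
  moreover have "smult e p = [:e:] * p" for e :: complex and p by simp
  ultimately show ?thesis unfolding Suc by (simp only: distrib_right pCons_one mult_1_left diff_Suc_1)
qed (simp add: square_factorial_def)

text \<open>In contrast to the other parameters, \<open>a\<close> also enters the basis, and the function to be
  decomposed is a difference of two cubics in \<open>k\<close>. Its cubic and quadratic parts cancel: the former
  because both cubics have leading coefficient \<open>\<epsilon>\<close>, the latter because the numerator and the
  denominator parameters are balanced.\<close>

lemma wilson_sum_shift_a:
  assumes "wilson_generic \<epsilon> a b c \<delta>"
  shows "wilson_sum \<epsilon> n a b c \<delta> \<in> lincomb {n - 1..n} (\<lambda>m. wilson_sum \<epsilon> m (a + 1) b c \<delta>)"
proof (rule wilson_sum_step[OF assms square_factorial_shift,
      where U = "\<lambda>j. (a + b + of_nat j) * (a + c + of_nat j) * (\<delta> + \<epsilon> * (a + of_nat j))" and V = "\<lambda>_. 1"])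
  fix n k :: nat
  define z where "z = (of_nat k :: complex)"
  define m where "m = (of_nat n :: complex)"
  have "1 * ((a + b + of_nat k) * (a + c + of_nat k) * (\<delta> + \<epsilon> * (a + of_nat k))) +
      (\<delta> + \<epsilon> * (of_nat n + a + b + c + of_nat k)) * (of_nat k - of_nat (Suc n)) *
        (- of_nat (Suc k) * (2 * a + of_nat (Suc k))) / (1 * of_nat (Suc k))
     = (a + b + z) * (a + c + z) * (\<delta> + \<epsilon> * (a + z)) -
       (\<delta> + \<epsilon> * (m + a + b + c + z)) * (z - m - 1) * (2 * a + 1 + z)"
    unfolding z_def m_def by (simp add: field_simps del: of_nat_Suc) (simp add: algebra_simps)
  also have "\<dots> = ((a + b) * (a + c) * (\<delta> + \<epsilon> * a) + (\<delta> + \<epsilon> * (m + a + b + c)) * (m + 1) * (2 * a + 1)) +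
     ((a + b) * (a + c) * \<epsilon> + (2 * a + b + c) * (\<delta> + \<epsilon> * a)
       - (\<delta> + \<epsilon> * (m + a + b + c)) * (2 * a - m) + \<epsilon> * (m + 1) * (2 * a + 1)) * z"
    by (simp add: algebra_simps)
  finally show "1 * ((a + b + of_nat k) * (a + c + of_nat k) * (\<delta> + \<epsilon> * (a + of_nat k))) +
      (\<delta> + \<epsilon> * (of_nat n + a + b + c + of_nat k)) * (of_nat k - of_nat (Suc n)) *
        (- of_nat (Suc k) * (2 * a + of_nat (Suc k))) / (1 * of_nat (Suc k))
    = ((a + b) * (a + c) * (\<delta> + \<epsilon> * a) + (\<delta> + \<epsilon> * (of_nat n + a + b + c)) * (of_nat n + 1) * (2 * a + 1)) +
     ((a + b) * (a + c) * \<epsilon> + (2 * a + b + c) * (\<delta> + \<epsilon> * a)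
       - (\<delta> + \<epsilon> * (of_nat n + a + b + c)) * (2 * a - of_nat n) + \<epsilon> * (of_nat n + 1) * (2 * a + 1)) * of_nat k"
    by (simp only: z_def m_def)
qed (simp_all add: algebra_simps)

lemma wilson_sum_shift_all:
  assumes "wilson_generic \<epsilon> a b c \<delta>"
  shows "wilson_sum \<epsilon> n a b c \<delta> \<in> lincomb {n - 4..n} (\<lambda>m. wilson_sum \<epsilon> m (a + 1) (b + 1) (c + 1) (\<delta> + \<epsilon>))"
proof -
  have 1: "wilson_generic \<epsilon> a (b + 1) c \<delta>" by (rule wilson_generic_shift[OF assms])
  have 2: "wilson_generic \<epsilon> a (b + 1) (c + 1) \<delta>" by (rule wilson_generic_shift[OF 1])
  have 3: "wilson_generic \<epsilon> a (b + 1) (c + 1) (\<delta> + \<epsilon>)" by (rule wilson_generic_shift[OF 2])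
  note * = lincomb_chain[OF lincomb_chain[OF lincomb_chain[OF wilson_sum_shift_b[OF assms]
    wilson_sum_shift_c[OF 1]] wilson_sum_shift_d[OF 2]] wilson_sum_shift_a[OF 3]]
  thus ?thesis by (simp add: numeral_eq_Suc)
qed

text \<open>One divided difference raises each of the four parameters by \<open>1/2\<close>, so two of them reach the
  parameters of \<open>wilson_sum_shift_all\<close>.\<close>

lemma ddiff_wilson_sum:
  assumes "wilson_generic \<epsilon> a b c \<delta>"
  shows "\<exists>\<kappa>. \<kappa> \<noteq> 0 \<and> ddiff square_lattice (wilson_sum \<epsilon> (Suc n) a b c \<delta>) =
    smult \<kappa> (wilson_sum \<epsilon> n (a + 1/2) (b + 1/2) (c + 1/2) (\<delta> + \<epsilon> / 2))"
proof -
  have shift: "\<delta> + \<epsilon> * (of_nat (Suc n) + a + b + c - 1 + of_nat (Suc j))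
      = \<delta> + \<epsilon> / 2 + \<epsilon> * (of_nat n + (a + 1/2) + (b + 1/2) + (c + 1/2) - 1 + of_nat j)"
    "(of_nat (Suc j) - of_nat (Suc n) :: complex) = of_nat j - of_nat n"
    "(a + b + of_nat (Suc j)) * (a + c + of_nat (Suc j)) * (\<delta> + \<epsilon> * (a + of_nat (Suc j))) =
     (a + 1/2 + (b + 1/2) + of_nat j) * (a + 1/2 + (c + 1/2) + of_nat j) * (\<delta> + \<epsilon> / 2 + \<epsilon> * (a + 1/2 + of_nat j))" for j
    by (simp_all add: field_simps)
  define \<kappa> where "\<kappa> = - 1 * ((\<delta> + \<epsilon> * (of_nat (Suc n) + a + b + c - 1 + of_nat 0)) * (of_nat 0 - of_nat (Suc n)) /
      ((a + b + of_nat 0) * (a + c + of_nat 0) * (\<delta> + \<epsilon> * (a + of_nat 0))))"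
  have "ddiff square_lattice (wilson_sum \<epsilon> (Suc n) a b c \<delta>) =
    smult \<kappa> (wilson_sum \<epsilon> n (a + 1/2) (b + 1/2) (c + 1/2) (\<delta> + \<epsilon> / 2))"
    unfolding wilson_sum_def \<kappa>_def
    by (subst square.hyper_sum_D[where \<gamma> = "- 1" and \<kappa> = "\<lambda>k. - of_nat (Suc k)" and \<psi> = "square_factorial (a + 1/2)"])
      (simp_all only: shift ddiff_square_factorial, simp_all add: square_factorial_def square.ddiff_1 field_simps del: of_nat_Suc)
  moreover have "\<kappa> \<noteq> 0"
  proof -
    have "(of_nat (Suc n) :: complex) \<noteq> 0" by (rule of_nat_neq_0)
    moreover have "\<delta> + \<epsilon> * (of_nat (Suc n) + a + b + c - 1 + of_nat 0) = \<delta> + \<epsilon> * (a + b + c + of_nat n)"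
      by (simp add: add_ac)
    ultimately show ?thesis
      unfolding \<kappa>_def using wilson_genericD[OF assms, of 0] wilson_genericD(4)[OF assms, of n]
      by (simp only: mult_eq_0_iff divide_eq_0_iff) (simp del: of_nat_Suc)
  qed
  ultimately show ?thesis by blast
qed

lemma wilson_sum_five_term:
  assumes "wilson_generic \<epsilon> a b c \<delta>"
  shows "square.five_term_relation (\<lambda>n. wilson_sum \<epsilon> n a b c \<delta>) n"
proof -
  have "\<exists>\<kappa>. \<kappa> \<noteq> 0 \<and> ddiff square_lattice (ddiff square_lattice (wilson_sum \<epsilon> (j + 2) a b c \<delta>)) =
    smult \<kappa> (wilson_sum \<epsilon> j (a + 1) (b + 1) (c + 1) (\<delta> + \<epsilon>))" for j
  proof -
    from ddiff_wilson_sum[OF assms, of "Suc j"] obtain \<kappa> where \<kappa>: "\<kappa> \<noteq> 0"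
      "ddiff square_lattice (wilson_sum \<epsilon> (Suc (Suc j)) a b c \<delta>) =
        smult \<kappa> (wilson_sum \<epsilon> (Suc j) (a + 1/2) (b + 1/2) (c + 1/2) (\<delta> + \<epsilon> / 2))" by blast
    from ddiff_wilson_sum[OF wilson_generic_shift(4)[OF assms], of j] obtain \<kappa>' where \<kappa>': "\<kappa>' \<noteq> 0"
      "ddiff square_lattice (wilson_sum \<epsilon> (Suc j) (a + 1/2) (b + 1/2) (c + 1/2) (\<delta> + \<epsilon> / 2)) =
        smult \<kappa>' (wilson_sum \<epsilon> j (a + 1/2 + 1/2) (b + 1/2 + 1/2) (c + 1/2 + 1/2) (\<delta> + \<epsilon> / 2 + \<epsilon> / 2))" by blast
    have "ddiff square_lattice (ddiff square_lattice (wilson_sum \<epsilon> (j + 2) a b c \<delta>)) =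
      smult (\<kappa> * \<kappa>') (wilson_sum \<epsilon> j (a + 1) (b + 1) (c + 1) (\<delta> + \<epsilon>))"
      using \<kappa>(2) \<kappa>'(2) by (simp add: square.smult add.assoc)
    thus ?thesis using \<kappa>(1) \<kappa>'(1) by (intro exI[of _ "\<kappa> * \<kappa>'"]) simp
  qed
  then obtain \<kappa> where \<kappa>: "\<And>j. \<kappa> j \<noteq> 0 \<and> ddiff square_lattice (ddiff square_lattice (wilson_sum \<epsilon> (j + 2) a b c \<delta>)) =
    smult (\<kappa> j) (wilson_sum \<epsilon> j (a + 1) (b + 1) (c + 1) (\<delta> + \<epsilon>))" by metis
  have "smult 1 (wilson_sum \<epsilon> n a b c \<delta>) \<in>
      lincomb {n - 4..n} (\<lambda>j. ddiff square_lattice (ddiff square_lattice (wilson_sum \<epsilon> (j + 2) a b c \<delta>)))"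
    by (rule lincomb_scale[OF wilson_sum_shift_all[OF assms], where d = \<kappa>]) (use \<kappa> in auto)
  thus ?thesis by (simp add: square.five_term_relation_def)
qed

section \<open>Askey--Wilson polynomials at generic parameters\<close>

definition q_weight :: "complex \<Rightarrow> nat \<Rightarrow> complex" where
  "q_weight q k = q ^ k / qpochhammer q q k"

definition aw_sum :: "complex \<Rightarrow> nat \<Rightarrow> complex \<Rightarrow> complex \<Rightarrow> complex \<Rightarrow> complex \<Rightarrow> complex poly" where
  "aw_sum q n a b c d =
    hyper_sum n (q_weight q) (\<lambda>j. 1 - a * b * c * d * q powi (int n - 1) * q ^ j) (\<lambda>j. 1 - q powi (- int n) * q ^ j)
      (\<lambda>j. (1 - a * b * q ^ j) * (1 - a * c * q ^ j) * (1 - a * d * q ^ j)) (q_factorial q a)"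

text \<open>As for the Wilson polynomials, the last condition makes the two numerator factors linearly
  independent as functions of \<open>q\<^sup>k\<close>.\<close>

definition aw_generic :: "complex \<Rightarrow> complex \<Rightarrow> complex \<Rightarrow> complex \<Rightarrow> complex \<Rightarrow> bool" where
  "aw_generic q a b c d \<longleftrightarrow> a \<noteq> 0 \<and> (\<forall>i::nat. a * b * q ^ i \<noteq> 1 \<and> a * c * q ^ i \<noteq> 1 \<and>
      a * d * q ^ i \<noteq> 1 \<and> a * b * c * d * q ^ i \<noteq> 1)"

lemma aw_genericD:
  assumes "aw_generic q a b c d"
  shows "a \<noteq> 0" "a * b * q ^ i \<noteq> 1" "a * c * q ^ i \<noteq> 1" "a * d * q ^ i \<noteq> 1" "a * b * c * d * q ^ i \<noteq> 1"
  using assms by (auto simp: aw_generic_def)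

lemma aw_generic_shift:
  assumes "aw_generic q a b c d"
  shows "aw_generic q a (b * q) c d" "aw_generic q a b (c * q) d" "aw_generic q a b c (d * q)"
proof -
  note * = aw_genericD[OF assms] and S = aw_genericD(2-)[OF assms, of "Suc i" for i]
  show "aw_generic q a (b * q) c d" "aw_generic q a b (c * q) d" "aw_generic q a b c (d * q)"
    unfolding aw_generic_def using * S by (simp_all add: mult_ac)
qed

lemma aw_generic_shift_all:
  assumes "aw_generic q a b c d" "r * r = q" "r \<noteq> 0"
  shows "aw_generic q (a * r) (b * r) (c * r) (d * r)"
proof -
  note * = aw_genericD[OF assms(1)] and S = aw_genericD(2-)[OF assms(1), of "Suc i" for i]
  have shift: "a * r * (y * r) * q ^ i = a * y * q ^ Suc i" for y i
    unfolding power_Suc assms(2)[symmetric] by (simp add: mult_ac)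
  have shift2: "a * r * (b * r) * (c * r) * (d * r) * q ^ i = a * b * c * d * q ^ Suc (Suc i)" for i
    unfolding power_Suc assms(2)[symmetric] by (simp add: mult_ac)
  show ?thesis
    unfolding aw_generic_def shift shift2
    using * S aw_genericD(5)[OF assms(1), of "Suc (Suc i)" for i] assms(3) by simp
qed

lemma aw_sum_0: "aw_sum q 0 a b c d = 1"
  by (simp add: aw_sum_def hyper_sum_def q_factorial_def q_weight_def qpochhammer_def)

context q_lattice_base
begin

lemma q_weight_Suc: "q_weight q (Suc k) = q_weight q k * q / (1 - q ^ Suc k)"
  by (simp add: q_weight_def qpochhammer_def)

lemma q_power_inj: "q powi (- int n) * q ^ j = 1 \<longleftrightarrow> j = n"
proof -
  have "q powi (- int n) * q ^ j = 1 \<longleftrightarrow> q ^ j = q ^ n"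
    using q_nz by (simp add: power_int_minus field_simps)
  also have "\<dots> \<longleftrightarrow> j = n"
  proof
    assume eq: "q ^ j = q ^ n"
    have "i = k" if "q ^ i = q ^ k" "i \<le> k" for i k
    proof (rule ccontr)
      assume "i \<noteq> k"
      then obtain m where m: "k = i + Suc m" using \<open>i \<le> k\<close> less_imp_Suc_add[of i k] by force
      have "q ^ i * 1 = q ^ i * q ^ Suc m" using that(1) unfolding m power_add by simp
      hence "q ^ Suc m = 1" using q_nz by (metis mult_cancel_left power_not_zero)
      thus False using q_power_ne_1 by blast
    qed
    from this[of j n] this[of n j] eq show "j = n" by (cases "j \<le> n") auto
  qed simp
  finally show ?thesis .
qed

lemma q_powi_shift: "q powi (- int (Suc n)) * q ^ Suc j = q powi (- int n) * q ^ j"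
  unfolding power_int_minus power_int_of_nat using q_nz by simp

text \<open>The analogue of \<open>wilson_sum_step\<close>, with \<open>q\<^sup>k\<close> in the place of \<open>k\<close> and multiplication of a
  parameter by \<open>q\<close> in the place of adding \<open>1\<close>.\<close>

lemma aw_sum_step:
  assumes gen: "aw_generic q a b c d"
    and \<phi>: "\<And>k. q_factorial q a k = smult (s k) (q_factorial q a' k) + smult (t k) (q_factorial q a' (k - 1))"
    and t0: "t 0 = 0"
    and UV: "\<And>j. (1 - a * b * q ^ j) * (1 - a * c * q ^ j) * (1 - a * d * q ^ j) = U j * V j"
    and UV': "\<And>j. (1 - a' * b' * q ^ j) * (1 - a' * c' * q ^ j) * (1 - a' * d' * q ^ j) = U (Suc j) * V j"
    and total: "a' * b' * c' * d' = a * b * c * d * q"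
    and key: "\<And>n k. s k * U k + (1 - a * b * c * d * q ^ n * q ^ k) * (1 - inverse (q ^ Suc n) * q ^ k) * t (Suc k) * q
        / (V k * (1 - q ^ Suc k)) = u0 n + u1 n * q ^ k"
  shows "aw_sum q n a b c d \<in> lincomb {n - 1..n} (\<lambda>m. aw_sum q m a' b' c' d')"
proof (cases n)
  case 0
  thus ?thesis by (intro lincombI[where c = "\<lambda>_. 1"]) (simp add: aw_sum_0)
next
  case (Suc m)
  define A where "A j = 1 - a * b * c * d * q ^ m * q ^ j" for j
  define B where "B j = 1 - q powi (- int (Suc m)) * q ^ j" for j
  have UV_nz: "U j \<noteq> 0" "V j \<noteq> 0" for j
    using UV[of j, symmetric] aw_genericD(2-)[OF gen, of j] by auto
  have A0: "A 0 \<noteq> 0" using aw_genericD(5)[OF gen, of m] by (simp add: A_def)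
  have B0: "B 0 \<noteq> 0" using q_power_inj[of "Suc m" 0] by (simp add: B_def)
  have inv: "q powi (- int (Suc m)) = inverse (q ^ Suc m)" by (metis power_int_minus power_int_of_nat)
  \<comment> \<open>the determinant of \<open>A\<close> and \<open>B\<close> as linear functions of \<open>q\<^sup>k\<close>\<close>
  have "1 * (- inverse (q ^ Suc m)) - (- (a * b * c * d * q ^ m)) * 1 \<noteq> 0"
  proof
    assume "1 * (- inverse (q ^ Suc m)) - (- (a * b * c * d * q ^ m)) * 1 = 0"
    hence "a * b * c * d * q ^ m = inverse (q ^ Suc m)" by simp
    hence "a * b * c * d * q ^ m * q ^ Suc m = inverse (q ^ Suc m) * q ^ Suc m" by (simp only:)
    also have "\<dots> = 1" using q_nz by (intro left_inverse) simp
    finally have "a * b * c * d * q ^ m * q ^ Suc m = 1" .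
    thus False using aw_genericD(5)[OF gen, of "m + Suc m"] by (simp only: power_add mult.assoc)
  qed
  then obtain \<alpha> \<beta> where lin: "\<And>z. \<alpha> * (1 + - (a * b * c * d * q ^ m) * z) + \<beta> * (1 + - inverse (q ^ Suc m) * z) = u0 m + u1 m * z"
    using linear_function_decomposition by blast
  have lin: "\<alpha> * A k + \<beta> * B k = u0 m + u1 m * q ^ k" for k
    unfolding A_def B_def inv using lin[of "q ^ k"] by (simp del: power_Suc)
  have m: "int (Suc m) - 1 = int m" by simp
  have qm: "q * q powi (int m - 1) = q ^ m"
    using q_nz power_int_add[of q 1 "int m - 1"] by simp
  have A: "1 - a * b * c * d * q powi (int (Suc m) - 1) * q ^ j = A j" for j
    by (simp add: A_def)
  have A1: "1 - a' * b' * c' * d' * q powi (int (Suc m) - 1) * q ^ j = A (Suc j)" for j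
    unfolding total by (simp add: A_def mult_ac)
  have A2: "1 - a' * b' * c' * d' * q powi (int m - 1) * q ^ j = A j" for j
    unfolding total A_def qm[symmetric] by (simp add: mult_ac)
  have B2: "1 - q powi (- int m) * q ^ j = B (Suc j)" for j
    by (simp only: B_def q_powi_shift)
  have "aw_sum q (Suc m) a b c d =
      smult (\<alpha> * A 0 / U 0) (aw_sum q (Suc m) a' b' c' d') +
      smult (\<beta> * B 0 / U 0) (aw_sum q m a' b' c' d')"
    unfolding aw_sum_def UV UV' A A1 A2 B2 B_def[symmetric]
  proof (rule hyper_sum_contiguous[where s = s and t = t])
    fix k
    have q1: "1 - q ^ Suc k \<noteq> 0" using q_power_ne_1[of k] by auto
    have "s k * U k * V k * q_weight q k + A k * B k * t (Suc k) * q_weight q (Suc k)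
        = V k * q_weight q k * (s k * U k + A k * B k * t (Suc k) * q / (V k * (1 - q ^ Suc k)))"
      unfolding q_weight_Suc using UV_nz q1 by (simp add: divide_simps del: power_Suc) (simp add: algebra_simps del: power_Suc)
    also have "\<dots> = V k * q_weight q k * (\<alpha> * A k + \<beta> * B k)"
      using key[of k m] lin[of k] by (simp only: A_def B_def inv)
    finally show "s k * U k * V k * q_weight q k + A k * B k * t (Suc k) * q_weight q (Suc k)
        = (\<alpha> * A k + \<beta> * B k) * V k * q_weight q k"
      by (simp add: mult_ac)
  next
    show "B (Suc m) = 0" using q_power_inj[of "Suc m" "Suc m"] by (simp add: B_def del: power_Suc)
  qed (simp_all only: A0 B0 UV_nz \<phi>[symmetric] t0 not_False_eq_True)
  thus ?thesis unfolding Suc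
    by (intro lincombI[where c = "\<lambda>k. if k = Suc m then \<alpha> * A 0 / U 0 else \<beta> * B 0 / U 0"])
      (simp add: atLeastAtMostSuc_conv)
qed

lemma aw_sum_shift_b:
  assumes "aw_generic q a b c d"
  shows "aw_sum q n a b c d \<in> lincomb {n - 1..n} (\<lambda>m. aw_sum q m a (b * q) c d)"
  by (rule aw_sum_step[OF assms, where s = "\<lambda>_. 1" and t = "\<lambda>_. 0" and U = "\<lambda>j. 1 - a * b * q ^ j"
      and V = "\<lambda>j. (1 - a * c * q ^ j) * (1 - a * d * q ^ j)" and ?u0.0 = "\<lambda>_. 1" and ?u1.0 = "\<lambda>_. - (a * b)"])
    (simp_all add: mult_ac)

lemma aw_sum_shift_c:
  assumes "aw_generic q a b c d"
  shows "aw_sum q n a b c d \<in> lincomb {n - 1..n} (\<lambda>m. aw_sum q m a b (c * q) d)"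
  by (rule aw_sum_step[OF assms, where s = "\<lambda>_. 1" and t = "\<lambda>_. 0" and U = "\<lambda>j. 1 - a * c * q ^ j"
      and V = "\<lambda>j. (1 - a * b * q ^ j) * (1 - a * d * q ^ j)" and ?u0.0 = "\<lambda>_. 1" and ?u1.0 = "\<lambda>_. - (a * c)"])
    (simp_all add: mult_ac)

lemma aw_sum_shift_d:
  assumes "aw_generic q a b c d"
  shows "aw_sum q n a b c d \<in> lincomb {n - 1..n} (\<lambda>m. aw_sum q m a b c (d * q))"
  by (rule aw_sum_step[OF assms, where s = "\<lambda>_. 1" and t = "\<lambda>_. 0" and U = "\<lambda>j. 1 - a * d * q ^ j"
      and V = "\<lambda>j. (1 - a * b * q ^ j) * (1 - a * c * q ^ j)" and ?u0.0 = "\<lambda>_. 1" and ?u1.0 = "\<lambda>_. - (a * d)"])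
    (simp_all add: mult_ac)

lemma q_factorial_shift:
  "q_factorial q a k = smult (inverse (q ^ k)) (q_factorial q (a * q) k) +
    smult ((1 - inverse (q ^ k)) * (1 - a\<^sup>2 * q ^ k)) (q_factorial q (a * q) (k - 1))"
proof (cases k)
  case (Suc m)
  define Q where "Q = q ^ Suc m"
  have Q: "Q \<noteq> 0" using q_nz by (simp add: Q_def)
  have "q_factorial q a (Suc m) = [:1 + a\<^sup>2, - 2 * a:] * q_factorial q (a * q) m"
    unfolding q_factorial_def prod.lessThan_Suc_shift by (simp add: mult_ac)
  moreover have "q_factorial q (a * q) (Suc m) = [:1 + (a * Q)\<^sup>2, - 2 * a * Q:] * q_factorial q (a * q) m"
    unfolding q_factorial_def Q_def by (simp add: mult_ac)
  moreover have "[:1 + a\<^sup>2, - 2 * a:] = smult (inverse Q) [:1 + (a * Q)\<^sup>2, - 2 * a * Q:] + [:(1 - inverse Q) * (1 - a\<^sup>2 * Q):]"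
    using Q by (simp add: power2_eq_square field_simps)
  moreover have "smult e p = [:e:] * p" for e :: complex and p by simp
  ultimately show ?thesis unfolding Suc Q_def[symmetric]
    by (simp only: distrib_right mult.assoc diff_Suc_1)
qed (simp add: q_factorial_def)

text \<open>With \<open>z = q\<^sup>k\<close> the function to be decomposed is \<open>1 / z\<close> times a difference of two cubics in \<open>z\<close>.
  Both have constant term \<open>1\<close>, and both have the same leading coefficient because the numerator
  parameters satisfy \<open>A B q = a b c d\<close>. Hence it is linear in \<open>z\<close>.\<close>

lemma aw_sum_shift_a:
  assumes "aw_generic q a b c d"
  shows "aw_sum q n a b c d \<in> lincomb {n - 1..n} (\<lambda>m. aw_sum q m (a * q) b c d)"
proof (rule aw_sum_step[OF assms q_factorial_shift,
      where U = "\<lambda>j. (1 - a * b * q ^ j) * (1 - a * c * q ^ j) * (1 - a * d * q ^ j)" and V = "\<lambda>_. 1"])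
  fix n k :: nat
  have q1: "1 - q ^ Suc k \<noteq> 0" using q_power_ne_1[of k] by auto
  have *: "inverse z * ((1 - a * b * z) * (1 - a * c * z) * (1 - a * d * z)) +
      (1 - A * z) * (1 - B * z) * ((1 - inverse (y * z)) * (1 - a\<^sup>2 * (y * z))) * y / (1 - y * z)
     = (A + B + a\<^sup>2 * y - a * b - a * c - a * d) +
       (a\<^sup>2 * (b * c + b * d + c * d) - A * B - a\<^sup>2 * y * (A + B)) * z" (is "_ = ?\<nu>")
    if nz: "z \<noteq> 0" "y \<noteq> 0" "1 - y * z \<noteq> 0" and AB: "A * B * y = a * b * c * d" for z y A B
  proof -
    have regroup: "p * (s * t) * y / N = p * t * (s * y / N)" for p s t N :: complex
      by simp
    have cancel: "(1 - inverse (y * z)) * y / (1 - y * z) = - inverse z"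
      using nz by (simp add: divide_simps)
    have "(1 - a * b * z) * (1 - a * c * z) * (1 - a * d * z) - (1 - A * z) * (1 - B * z) * (1 - a\<^sup>2 * (y * z))
       = ?\<nu> * z + (a\<^sup>2 * (A * B * y) - a\<^sup>2 * (a * b * c * d)) * z ^ 3"
      by (simp add: algebra_simps power2_eq_square power3_eq_cube)
    hence cubic: "(1 - a * b * z) * (1 - a * c * z) * (1 - a * d * z) - (1 - A * z) * (1 - B * z) * (1 - a\<^sup>2 * (y * z)) = ?\<nu> * z"
      unfolding AB by simp
    have "inverse z * X + Y * (- inverse z) = (X - Y) * inverse z" for X Y
      by (simp add: algebra_simps)
    thus ?thesis unfolding regroup cancel using nz(1) by (simp only: cubic) simp
  qed
  have AB: "a * b * c * d * q ^ n * inverse (q ^ Suc n) * q = a * b * c * d"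
  proof -
    have "a * b * c * d * q ^ n * inverse (q ^ Suc n) * q = a * b * c * d * (inverse (q ^ Suc n) * q ^ Suc n)"
      by (simp only: power_Suc mult_ac)
    thus ?thesis using q_nz by (simp del: power_Suc)
  qed
  show "inverse (q ^ k) * ((1 - a * b * q ^ k) * (1 - a * c * q ^ k) * (1 - a * d * q ^ k)) +
      (1 - a * b * c * d * q ^ n * q ^ k) * (1 - inverse (q ^ Suc n) * q ^ k) *
      ((1 - inverse (q ^ Suc k)) * (1 - a\<^sup>2 * q ^ Suc k)) * q / (1 * (1 - q ^ Suc k))
    = (a * b * c * d * q ^ n + inverse (q ^ Suc n) + a\<^sup>2 * q - a * b - a * c - a * d) +
       (a\<^sup>2 * (b * c + b * d + c * d) - a * b * c * d * q ^ n * inverse (q ^ Suc n)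
         - a\<^sup>2 * q * (a * b * c * d * q ^ n + inverse (q ^ Suc n))) * q ^ k"
    using *[OF _ q_nz _ AB, of "q ^ k"] q_nz q1 by (simp only: power_Suc mult_1_left power_not_zero not_False_eq_True simp_thms)
qed (simp_all add: mult_ac)

lemma aw_sum_shift_all:
  assumes "aw_generic q a b c d"
  shows "aw_sum q n a b c d \<in> lincomb {n - 4..n} (\<lambda>m. aw_sum q m (a * q) (b * q) (c * q) (d * q))"
proof -
  have 1: "aw_generic q a (b * q) c d" by (rule aw_generic_shift[OF assms])
  have 2: "aw_generic q a (b * q) (c * q) d" by (rule aw_generic_shift[OF 1])
  have 3: "aw_generic q a (b * q) (c * q) (d * q)" by (rule aw_generic_shift[OF 2])
  note * = lincomb_chain[OF lincomb_chain[OF lincomb_chain[OF aw_sum_shift_b[OF assms]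
    aw_sum_shift_c[OF 1]] aw_sum_shift_d[OF 2]] aw_sum_shift_a[OF 3]]
  thus ?thesis by (simp add: numeral_eq_Suc)
qed

text \<open>With \<open>r\<^sup>2 = q\<close>, one divided difference multiplies each of the four parameters by \<open>r\<close>, so two of them
  reach the parameters of \<open>aw_sum_shift_all\<close>.\<close>

lemma ddiff_aw_sum:
  assumes "aw_generic q a b c d"
  shows "\<exists>\<kappa>. \<kappa> \<noteq> 0 \<and> ddiff (q_lattice q) (aw_sum q (Suc n) a b c d) =
    smult \<kappa> (aw_sum q n (a * r) (b * r) (c * r) (d * r))"
proof -
  have qn: "q * q powi (int n - 1) = q ^ n"
    using q_nz power_int_add[of q 1 "int n - 1"] by simp
  have rr: "r * (r * y) = q * y" for y by (simp add: r_square mult.assoc[symmetric])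
  have shiftA: "1 - a * b * c * d * q powi (int (Suc n) - 1) * q ^ Suc j
      = 1 - a * r * (b * r) * (c * r) * (d * r) * q powi (int n - 1) * q ^ j" for j
  proof -
    have "a * r * (b * r) * (c * r) * (d * r) * q powi (int n - 1) * q ^ j
        = a * b * c * d * (r * r) * ((r * r) * q powi (int n - 1)) * q ^ j" by (simp only: mult_ac)
    also have "\<dots> = a * b * c * d * q ^ n * q ^ Suc j"
      unfolding r_square qn by (simp add: mult_ac)
    finally have eq: "a * r * (b * r) * (c * r) * (d * r) * q powi (int n - 1) * q ^ j
        = a * b * c * d * q ^ n * q ^ Suc j" .
    show ?thesis unfolding eq by simp
  qed
  have shiftB: "1 - q powi (- int (Suc n)) * q ^ Suc j = 1 - q powi (- int n) * q ^ j" for j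
    by (simp only: q_powi_shift)
  have shiftE: "a * y * q ^ Suc j = a * r * (y * r) * q ^ j" for j y
    by (simp add: mult_ac rr)
  define \<kappa> where "\<kappa> = 2 * a * q / (q - 1) * ((1 - a * b * c * d * q powi (int (Suc n) - 1) * q ^ 0) *
      (1 - q powi (- int (Suc n)) * q ^ 0) / ((1 - a * b * q ^ 0) * (1 - a * c * q ^ 0) * (1 - a * d * q ^ 0)))"
  have "ddiff (q_lattice q) (aw_sum q (Suc n) a b c d) = smult \<kappa> (aw_sum q n (a * r) (b * r) (c * r) (d * r))"
    unfolding aw_sum_def \<kappa>_def shiftA[symmetric] shiftB[symmetric] shiftE[symmetric]
  proof (rule hyper_sum_D)
    show "ddiff (q_lattice q) (q_factorial q a 0) = 0" by (simp add: q_factorial_def ddiff_1)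
    show "ddiff (q_lattice q) (q_factorial q a (Suc k)) = smult (2 * a * (1 - q ^ Suc k) / (q - 1)) (q_factorial q (a * r) k)" for k
      by (rule ddiff_q_factorial)
    fix k
    have q1: "1 - q ^ Suc k \<noteq> 0" using q_power_ne_1[of k] by auto
    have "w * q / y * (2 * a * y / z) = 2 * a * q / z * w" if "y \<noteq> 0" for w y z :: complex
      using that by simp
    thus "q_weight q (Suc k) * (2 * a * (1 - q ^ Suc k) / (q - 1)) = 2 * a * q / (q - 1) * q_weight q k"
      unfolding q_weight_Suc using q1 by blast
  qed
  moreover have "\<kappa> \<noteq> 0"
  proof -
    have "1 - a * b * c * d * q powi (int (Suc n) - 1) * q ^ 0 \<noteq> 0"
      using aw_genericD(5)[OF assms, of n] by simp
    moreover have "1 - q powi (- int (Suc n)) * q ^ 0 \<noteq> 0"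
      using q_power_inj[of "Suc n" 0] by simp
    ultimately show ?thesis
      unfolding \<kappa>_def using aw_genericD(1)[OF assms] aw_genericD(2-4)[OF assms, of 0] q_nz q_ne_1
      by (simp only: mult_eq_0_iff divide_eq_0_iff) simp
  qed
  ultimately show ?thesis by blast
qed

lemma aw_sum_five_term:
  assumes "aw_generic q a b c d"
  shows "five_term_relation (\<lambda>n. aw_sum q n a b c d) n"
proof -
  have "\<exists>\<kappa>. \<kappa> \<noteq> 0 \<and> ddiff (q_lattice q) (ddiff (q_lattice q) (aw_sum q (j + 2) a b c d)) =
    smult \<kappa> (aw_sum q j (a * q) (b * q) (c * q) (d * q))" for j
  proof -
    from ddiff_aw_sum[OF assms, of "Suc j"] obtain \<kappa> where \<kappa>: "\<kappa> \<noteq> 0"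
      "ddiff (q_lattice q) (aw_sum q (Suc (Suc j)) a b c d) =
        smult \<kappa> (aw_sum q (Suc j) (a * r) (b * r) (c * r) (d * r))" by blast
    from ddiff_aw_sum[OF aw_generic_shift_all[OF assms r_square r_nz], of j] obtain \<kappa>' where \<kappa>': "\<kappa>' \<noteq> 0"
      "ddiff (q_lattice q) (aw_sum q (Suc j) (a * r) (b * r) (c * r) (d * r)) =
        smult \<kappa>' (aw_sum q j (a * r * r) (b * r * r) (c * r * r) (d * r * r))" by blast
    have "ddiff (q_lattice q) (ddiff (q_lattice q) (aw_sum q (j + 2) a b c d)) =
      smult (\<kappa> * \<kappa>') (aw_sum q j (a * q) (b * q) (c * q) (d * q))"
      using \<kappa>(2) \<kappa>'(2) by (simp add: smult mult.assoc r_square)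
    thus ?thesis using \<kappa>(1) \<kappa>'(1) by (intro exI[of _ "\<kappa> * \<kappa>'"]) simp
  qed
  then obtain \<kappa> where \<kappa>: "\<And>j. \<kappa> j \<noteq> 0 \<and> ddiff (q_lattice q) (ddiff (q_lattice q) (aw_sum q (j + 2) a b c d)) =
    smult (\<kappa> j) (aw_sum q j (a * q) (b * q) (c * q) (d * q))" by metis
  have "smult 1 (aw_sum q n a b c d) \<in>
      lincomb {n - 4..n} (\<lambda>j. ddiff (q_lattice q) (ddiff (q_lattice q) (aw_sum q (j + 2) a b c d)))"
    by (rule lincomb_scale[OF aw_sum_shift_all[OF assms], where d = \<kappa>]) (use \<kappa> in auto)
  thus ?thesis by (simp add: five_term_relation_def)
qed

end

section \<open>Passing to arbitrary parameters\<close>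

lemma at_within_co_countable_neq_bot:
  fixes C :: "complex set"
  assumes "countable C"
  shows "at x within - C \<noteq> bot"
proof -
  have "x islimpt - C"
    unfolding islimpt_def
  proof (intro allI impI)
    fix T assume T: "x \<in> T" "open T"
    then obtain e where e: "e > 0" "ball x e \<subseteq> T" by (auto simp: open_contains_ball)
    have "uncountable (ball x e - (insert x C))"
      using uncountable_ball[OF e(1)] assms by (intro uncountable_minus_countable) auto
    hence "ball x e - insert x C \<noteq> {}" using countable_empty by metis
    thus "\<exists>y\<in>- C. y \<in> T \<and> y \<noteq> x" using e(2) by blast
  qed
  thus ?thesis by (simp add: trivial_limit_within)
qed

text \<open>A curve \<open>v\<close> that tends to the given parameters \<open>u\<close> and is generic outside a countable set \<open>C\<close>
  (countable, not finite, since genericity consists of infinitely many conditions) reaches every member of the family at once as a limit of generic members: those that are regular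
  at \<open>u\<close> by continuity, the others by the definition of the extension. The set of regular parameters
  depends on the degree \<open>m\<close>, whereas the curve serves all degrees.\<close>

lemma (in lowering_operator) five_term_relation_continuous_extension:
  fixes v :: "complex \<Rightarrow> 'p::topological_space"
  assumes C: "countable C"
    and v: "(v \<longlongrightarrow> u) (at 0)" "\<And>t. t \<noteq> 0 \<Longrightarrow> v t \<noteq> u"
    and G: "\<And>t m. t \<notin> C \<Longrightarrow> v t \<in> G m"
    and rel: "\<And>t. t \<notin> C \<Longrightarrow> five_term_relation (\<lambda>m. F m (v t)) n"
    and deg: "\<And>m w. w \<in> G m \<Longrightarrow> degree (F m w) \<le> m"
    and cont: "\<And>m. u \<in> G m \<Longrightarrow> coeff_tendsto (\<lambda>t. F m (v t)) (F m u) (at 0 within - C)"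
    and P: "\<And>m. m \<le> n + 2 \<Longrightarrow> continuous_extension (G m) (F m) u (P m) \<and> degree (P m) = m"
  shows "five_term_relation P n"
proof (rule five_term_relation_limit[where F = "at 0 within - C" and f = "\<lambda>t m. F m (v t)"])
  have ev: "\<forall>\<^sub>F t in at 0 within - C. t \<notin> C \<and> t \<noteq> 0"
    by (simp add: eventually_at_filter)
  show "at 0 within - C \<noteq> bot" by (rule at_within_co_countable_neq_bot[OF C])
  show "\<forall>\<^sub>F t in at 0 within - C. five_term_relation (\<lambda>m. F m (v t)) n"
    using ev by eventually_elim (simp add: rel)
  show "\<forall>\<^sub>F t in at 0 within - C. degree (F m (v t)) \<le> m" for m
    using ev by eventually_elim (simp add: deg G)
  fix m assume m: "m \<le> n + 2"
  show "degree (P m) = m" using P[OF m] by simp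
  show "coeff_tendsto (\<lambda>t. F m (v t)) (P m) (at 0 within - C)"
  proof (cases "u \<in> G m")
    case True
    thus ?thesis using cont[OF True] P[OF m] by (simp add: continuous_extension_def)
  next
    case False
    have "filterlim v (at u within G m) (at 0 within - C)"
      unfolding filterlim_at
    proof
      show "\<forall>\<^sub>F t in at 0 within - C. v t \<in> G m \<and> v t \<noteq> u"
        using ev by eventually_elim (simp add: v G)
      show "(v \<longlongrightarrow> u) (at 0 within - C)" by (rule tendsto_mono[OF _ v(1)]) (simp add: at_le)
    qed
    thus ?thesis
      using P[OF m] False
      by (auto simp: coeff_tendsto_def continuous_extension_def intro: filterlim_compose)
  qed
qed

lemma countable_roots:
  fixes p :: "complex poly"
  assumes "degree p > 0"
  shows "countable {t. poly p t = 0}" "countable {t. poly p t * e = 1}"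
proof -
  have "p \<noteq> 0" using assms by auto
  thus "countable {t. poly p t = 0}" by (intro countable_finite poly_roots_finite)
  have "p - [:1 / e:] \<noteq> 0"
  proof
    assume "p - [:1 / e:] = 0"
    hence "p = [:1 / e:]" by simp
    thus False using assms by simp
  qed
  hence "finite {t. poly (p - [:1 / e:]) t = 0}" by (rule poly_roots_finite)
  moreover have "{t. poly p t * e = 1} \<subseteq> {t. poly (p - [:1 / e:]) t = 0}"
    by (cases "e = 0") (auto simp: field_simps)
  ultimately show "countable {t. poly p t * e = 1}"
    by (meson countable_finite finite_subset)
qed

lemma wilson_poly_eq_sum:
  assumes "(a, b, c, d) \<in> wilson_regular n"
  shows "wilson_poly n (a, b, c, d) =
    smult (pochhammer (a + b) n * pochhammer (a + c) n * pochhammer (a + d) n) (wilson_sum 1 n a b c d)"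
proof -
  have factors: "d + 1 * (of_nat n + a + b + c - 1 + of_nat j) = of_nat n + a + b + c + d - 1 + of_nat j"
    "of_nat j - of_nat n = - of_nat n + (of_nat j :: complex)" "d + 1 * (a + of_nat j) = a + d + of_nat j" for j
    by simp_all
  show ?thesis
    unfolding wilson_poly_explicit[OF assms] wilson_sum_def hyper_sum_def square_factorial_def[symmetric] factors
    by (intro arg_cong[where f = "smult _"] sum.cong refl arg_cong2[where f = smult])
      (simp add: pochhammer_prod atLeast0LessThan prod.distrib prod_dividef mult_ac)
qed

lemma cdh_poly_eq_sum:
  assumes "(a, b, c) \<in> cdh_regular n"
  shows "cdh_poly n (a, b, c) =
    smult (pochhammer (a + b) n * pochhammer (a + c) n) (wilson_sum 0 n a b c 1)"
proof -
  have factors: "of_nat j - of_nat n = - of_nat n + (of_nat j :: complex)" for j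
    by simp
  show ?thesis
    unfolding cdh_poly_explicit[OF assms] wilson_sum_def hyper_sum_def square_factorial_def[symmetric] factors
    by (intro arg_cong[where f = "smult _"] sum.cong refl arg_cong2[where f = smult])
      (simp add: pochhammer_prod atLeast0LessThan prod.distrib prod_dividef mult_ac)
qed

lemma degree_wilson_sum_le: "degree (wilson_sum \<epsilon> n a b c \<delta>) \<le> n"
  unfolding wilson_sum_def by (rule degree_hyper_sum_le) (simp add: degree_square_factorial)

lemma coeff_tendsto_square_factorial:
  assumes "(a \<longlongrightarrow> a') F"
  shows "coeff_tendsto (\<lambda>t. square_factorial (a t) k) (square_factorial a' k) F"
  unfolding square_factorial_def
  by (intro coeff_tendsto_prod coeff_tendsto_linear tendsto_intros assms)

lemma coeff_tendsto_wilson_sum: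
  assumes "(a \<longlongrightarrow> a') F" "(b \<longlongrightarrow> b') F" "(c \<longlongrightarrow> c') F" "(\<delta> \<longlongrightarrow> \<delta>') F"
    and "\<And>j. j < n \<Longrightarrow> a' + b' + of_nat j \<noteq> 0 \<and> a' + c' + of_nat j \<noteq> 0 \<and> \<delta>' + \<epsilon> * (a' + of_nat j) \<noteq> 0"
  shows "coeff_tendsto (\<lambda>t. wilson_sum \<epsilon> n (a t) (b t) (c t) (\<delta> t)) (wilson_sum \<epsilon> n a' b' c' \<delta>') F"
  unfolding wilson_sum_def
proof (rule coeff_tendsto_hyper_sum)
  show "((\<lambda>t. \<delta> t + \<epsilon> * (of_nat n + a t + b t + c t - 1 + of_nat j)) \<longlongrightarrow>
      \<delta>' + \<epsilon> * (of_nat n + a' + b' + c' - 1 + of_nat j)) F" for j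
    by (intro tendsto_intros assms(1-4))
  show "((\<lambda>t. (a t + b t + of_nat j) * (a t + c t + of_nat j) * (\<delta> t + \<epsilon> * (a t + of_nat j))) \<longlongrightarrow>
      (a' + b' + of_nat j) * (a' + c' + of_nat j) * (\<delta>' + \<epsilon> * (a' + of_nat j))) F" for j
    by (intro tendsto_intros assms(1-4))
qed (use assms(5) in \<open>auto intro: coeff_tendsto_square_factorial assms(1)\<close>)

lemma tendsto_pochhammer:
  fixes f :: "'v \<Rightarrow> complex"
  assumes "(f \<longlongrightarrow> l) F"
  shows "((\<lambda>t. pochhammer (f t) n) \<longlongrightarrow> pochhammer l n) F"
  unfolding pochhammer_prod by (intro tendsto_prod tendsto_add tendsto_const assms)

lemma pochhammer_factor_ne_0: "pochhammer (x :: complex) n \<noteq> 0 \<Longrightarrow> j < n \<Longrightarrow> x + of_nat j \<noteq> 0"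
  by (auto simp: pochhammer_prod prod_zero_iff)

lemma tendsto_shift: "((\<lambda>t. a + t) \<longlongrightarrow> (a :: complex)) (at 0 within S)"
  by (rule tendsto_eq_intros refl | simp)+

text \<open>All parameters are moved by the same \<open>t\<close>: every condition of genericity then becomes the
  nonvanishing of a nonconstant polynomial in \<open>t\<close>.\<close>

lemma wilson_five_term:
  assumes P: "\<And>m. m \<le> n + 2 \<Longrightarrow> is_wilson m u (P m) \<and> degree (P m) = m"
  shows "square.five_term_relation P n"
proof -
  obtain a b c d where u: "u = (a, b, c, d)" by (cases u) auto
  define C where "C = {t. \<not> wilson_generic 1 (a + t) (b + t) (c + t) (d + t)}"
  have C: "countable C"
  proof -
    have "C \<subseteq> (\<Union>i::nat. {t. poly [:a + b + of_nat i, 2:] t = 0} \<union> {t. poly [:a + c + of_nat i, 2:] t = 0} \<union>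
        {t. poly [:a + d + of_nat i, 2:] t = 0} \<union> {t. poly [:a + b + c + d + of_nat i, 4:] t = 0})"
      unfolding C_def wilson_generic_def by (auto simp: algebra_simps)
    moreover have "countable \<dots>"
      by (intro countable_UN countable_Un countable_roots(1)) auto
    ultimately show ?thesis by (rule countable_subset)
  qed
  have reg: "(a + t, b + t, c + t, d + t) \<in> wilson_regular m" if "t \<notin> C" for t m
    using that wilson_genericD[of 1 "a + t" "b + t" "c + t" "d + t"]
    by (auto simp: C_def wilson_regular_def pochhammer_prod prod_zero_iff add_ac)
  have reg_nz: "pochhammer (x + y) m * pochhammer (x + z) m * pochhammer (x + w) m \<noteq> 0"
    if "(x, y, z, w) \<in> wilson_regular m" for x y z w m
    using that by (simp add: wilson_regular_def)
  show ?thesis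
  proof (rule square.five_term_relation_continuous_extension[OF C,
        where v = "\<lambda>t. (a + t, b + t, c + t, d + t)" and u = u and G = wilson_regular and F = wilson_poly])
    show "((\<lambda>t. (a + t, b + t, c + t, d + t)) \<longlongrightarrow> u) (at 0)"
      unfolding u by (intro tendsto_Pair tendsto_shift)
    show "t \<noteq> 0 \<Longrightarrow> (a + t, b + t, c + t, d + t) \<noteq> u" for t by (simp add: u)
    show "t \<notin> C \<Longrightarrow> (a + t, b + t, c + t, d + t) \<in> wilson_regular m" for t m by (rule reg)
    show "square.five_term_relation (\<lambda>m. wilson_poly m (a + t, b + t, c + t, d + t)) n" if "t \<notin> C" for t
    proof (rule square.five_term_relation_scale[OF wilson_sum_five_term])
      show "wilson_generic 1 (a + t) (b + t) (c + t) (d + t)" using that by (simp add: C_def)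
      show "pochhammer (a + t + (b + t)) m * pochhammer (a + t + (c + t)) m * pochhammer (a + t + (d + t)) m \<noteq> 0 \<and>
        wilson_poly m (a + t, b + t, c + t, d + t) = smult (pochhammer (a + t + (b + t)) m * pochhammer (a + t + (c + t)) m * pochhammer (a + t + (d + t)) m)
          (wilson_sum 1 m (a + t) (b + t) (c + t) (d + t))" for m
        using reg_nz[OF reg[OF that]] wilson_poly_eq_sum[OF reg[OF that]] by blast
    qed
    show "degree (wilson_poly m w) \<le> m" if "w \<in> wilson_regular m" for m w
    proof -
      obtain a b c d where "w = (a, b, c, d)" by (cases w) auto
      thus ?thesis using that wilson_poly_eq_sum degree_wilson_sum_le
        by (auto intro: order.trans[OF degree_smult_le])
    qed
    show "continuous_extension (wilson_regular m) (wilson_poly m) u (P m) \<and> degree (P m) = m" if "m \<le> n + 2" for m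
      using P[OF that] by (simp add: is_wilson_def)
    fix m assume um: "u \<in> wilson_regular m"
    have "coeff_tendsto (\<lambda>t. smult (pochhammer (a + t + (b + t)) m * pochhammer (a + t + (c + t)) m * pochhammer (a + t + (d + t)) m)
        (wilson_sum 1 m (a + t) (b + t) (c + t) (d + t))) (wilson_poly m u) (at 0 within - C)"
      unfolding u wilson_poly_eq_sum[OF um[unfolded u]]
      by (intro coeff_tendsto_smult coeff_tendsto_wilson_sum tendsto_mult tendsto_pochhammer tendsto_add tendsto_shift)
        (use um in \<open>auto simp: u wilson_regular_def add_ac dest: pochhammer_factor_ne_0\<close>)
    thus "coeff_tendsto (\<lambda>t. wilson_poly m (a + t, b + t, c + t, d + t)) (wilson_poly m u) (at 0 within - C)"
      by (rule coeff_tendsto_cong[rotated]) (unfold eventually_at_filter, intro always_eventually allI impI wilson_poly_eq_sum reg, simp)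
  qed
qed

lemma cdh_five_term:
  assumes P: "\<And>m. m \<le> n + 2 \<Longrightarrow> is_cdh m u (P m) \<and> degree (P m) = m"
  shows "square.five_term_relation P n"
proof -
  obtain a b c where u: "u = (a, b, c)" by (cases u) auto
  define C where "C = {t. \<not> wilson_generic 0 (a + t) (b + t) (c + t) 1}"
  have C: "countable C"
  proof -
    have "C \<subseteq> (\<Union>i::nat. {t. poly [:a + b + of_nat i, 2:] t = 0} \<union> {t. poly [:a + c + of_nat i, 2:] t = 0})"
      unfolding C_def wilson_generic_def by (auto simp: algebra_simps)
    moreover have "countable \<dots>"
      by (intro countable_UN countable_Un countable_roots(1)) auto
    ultimately show ?thesis by (rule countable_subset)
  qed
  have reg: "(a + t, b + t, c + t) \<in> cdh_regular m" if "t \<notin> C" for t m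
    using that wilson_genericD[of 0 "a + t" "b + t" "c + t" 1]
    by (auto simp: C_def cdh_regular_def pochhammer_prod prod_zero_iff add_ac)
  have reg_nz: "pochhammer (x + y) m * pochhammer (x + z) m \<noteq> 0"
    if "(x, y, z) \<in> cdh_regular m" for x y z m
    using that by (simp add: cdh_regular_def)
  show ?thesis
  proof (rule square.five_term_relation_continuous_extension[OF C,
        where v = "\<lambda>t. (a + t, b + t, c + t)" and u = u and G = cdh_regular and F = cdh_poly])
    show "((\<lambda>t. (a + t, b + t, c + t)) \<longlongrightarrow> u) (at 0)"
      unfolding u by (intro tendsto_Pair tendsto_shift)
    show "t \<noteq> 0 \<Longrightarrow> (a + t, b + t, c + t) \<noteq> u" for t by (simp add: u)
    show "t \<notin> C \<Longrightarrow> (a + t, b + t, c + t) \<in> cdh_regular m" for t m by (rule reg)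
    show "square.five_term_relation (\<lambda>m. cdh_poly m (a + t, b + t, c + t)) n" if "t \<notin> C" for t
    proof (rule square.five_term_relation_scale[OF wilson_sum_five_term])
      show "wilson_generic 0 (a + t) (b + t) (c + t) 1" using that by (simp add: C_def)
      show "pochhammer (a + t + (b + t)) m * pochhammer (a + t + (c + t)) m \<noteq> 0 \<and>
        cdh_poly m (a + t, b + t, c + t) = smult (pochhammer (a + t + (b + t)) m * pochhammer (a + t + (c + t)) m)
          (wilson_sum 0 m (a + t) (b + t) (c + t) 1)" for m
        using reg_nz[OF reg[OF that]] cdh_poly_eq_sum[OF reg[OF that]] by blast
    qed
    show "degree (cdh_poly m w) \<le> m" if "w \<in> cdh_regular m" for m w
    proof -
      obtain a b c where "w = (a, b, c)" by (cases w) auto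
      thus ?thesis using that cdh_poly_eq_sum degree_wilson_sum_le
        by (auto intro: order.trans[OF degree_smult_le])
    qed
    show "continuous_extension (cdh_regular m) (cdh_poly m) u (P m) \<and> degree (P m) = m" if "m \<le> n + 2" for m
      using P[OF that] by (simp add: is_cdh_def)
    fix m assume um: "u \<in> cdh_regular m"
    have "coeff_tendsto (\<lambda>t. smult (pochhammer (a + t + (b + t)) m * pochhammer (a + t + (c + t)) m)
        (wilson_sum 0 m (a + t) (b + t) (c + t) 1)) (cdh_poly m u) (at 0 within - C)"
      unfolding u cdh_poly_eq_sum[OF um[unfolded u]]
      by (intro coeff_tendsto_smult coeff_tendsto_wilson_sum tendsto_mult tendsto_pochhammer tendsto_add tendsto_shift tendsto_const)
        (use um in \<open>auto simp: u cdh_regular_def add_ac dest: pochhammer_factor_ne_0\<close>)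
    thus "coeff_tendsto (\<lambda>t. cdh_poly m (a + t, b + t, c + t)) (cdh_poly m u) (at 0 within - C)"
      by (rule coeff_tendsto_cong[rotated]) (unfold eventually_at_filter, intro always_eventually allI impI cdh_poly_eq_sum reg, simp)
  qed
qed

lemma tendsto_qpochhammer:
  "(f \<longlongrightarrow> l) F \<Longrightarrow> ((\<lambda>t. qpochhammer (f t) q n) \<longlongrightarrow> qpochhammer l q n) F"
  unfolding qpochhammer_def by (intro tendsto_intros)

lemma qpochhammer_factor_ne_0: "qpochhammer x q n \<noteq> 0 \<Longrightarrow> j < n \<Longrightarrow> 1 - x * q ^ j \<noteq> 0"
  by (auto simp: qpochhammer_def prod_zero_iff)

context q_lattice_base
begin

lemma aw_poly_eq_sum:
  assumes "(a, b, c, d) \<in> aw_regular q n"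
  shows "aw_poly q n (a, b, c, d) =
    smult (qpochhammer (a * b) q n * qpochhammer (a * c) q n * qpochhammer (a * d) q n / a ^ n) (aw_sum q n a b c d)"
  unfolding aw_poly_explicit[OF q_nz assms] aw_sum_def hyper_sum_def q_factorial_def[symmetric] q_weight_def
  by (intro arg_cong[where f = "smult _"] sum.cong refl arg_cong2[where f = smult])
    (simp add: qpochhammer_def prod.distrib prod_dividef mult_ac)

lemma degree_aw_sum_le: "degree (aw_sum q n a b c d) \<le> n"
  unfolding aw_sum_def by (rule degree_hyper_sum_le) (rule degree_q_factorial_le)

lemma coeff_tendsto_q_factorial:
  assumes "(a \<longlongrightarrow> a') F"
  shows "coeff_tendsto (\<lambda>t. q_factorial q (a t) k) (q_factorial q a' k) F"
  unfolding q_factorial_def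
  by (intro coeff_tendsto_prod coeff_tendsto_linear tendsto_intros assms)

lemma coeff_tendsto_aw_sum:
  assumes "(a \<longlongrightarrow> a') F" "(b \<longlongrightarrow> b') F" "(c \<longlongrightarrow> c') F" "(d \<longlongrightarrow> d') F"
    and "\<And>j. j < n \<Longrightarrow> 1 - a' * b' * q ^ j \<noteq> 0 \<and> 1 - a' * c' * q ^ j \<noteq> 0 \<and> 1 - a' * d' * q ^ j \<noteq> 0"
  shows "coeff_tendsto (\<lambda>t. aw_sum q n (a t) (b t) (c t) (d t)) (aw_sum q n a' b' c' d') F"
  unfolding aw_sum_def
proof (rule coeff_tendsto_hyper_sum)
  show "((\<lambda>t. 1 - a t * b t * c t * d t * q powi (int n - 1) * q ^ j) \<longlongrightarrow>
      1 - a' * b' * c' * d' * q powi (int n - 1) * q ^ j) F" for j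
    by (intro tendsto_diff tendsto_mult tendsto_const assms(1-4))
  show "((\<lambda>t. (1 - a t * b t * q ^ j) * (1 - a t * c t * q ^ j) * (1 - a t * d t * q ^ j)) \<longlongrightarrow>
      (1 - a' * b' * q ^ j) * (1 - a' * c' * q ^ j) * (1 - a' * d' * q ^ j)) F" for j
    by (intro tendsto_diff tendsto_mult tendsto_const assms(1-4))
qed (use assms(5) in \<open>auto intro: coeff_tendsto_q_factorial assms(1)\<close>)

lemma aw_five_term:
  assumes P: "\<And>m. m \<le> n + 2 \<Longrightarrow> is_askey_wilson q m u (P m) \<and> degree (P m) = m"
  shows "five_term_relation P n"
proof -
  obtain a b c d where u: "u = (a, b, c, d)" by (cases u) auto
  define C where "C = {t. \<not> aw_generic q (a + t) (b + t) (c + t) (d + t)}"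
  have C: "countable C"
  proof -
    let ?R = "\<lambda>p i. {t. poly p t * q ^ i = 1}"
    have "C \<subseteq> {- a} \<union> (\<Union>i::nat. ?R ([:a, 1:] * [:b, 1:]) i \<union> ?R ([:a, 1:] * [:c, 1:]) i \<union>
        ?R ([:a, 1:] * [:d, 1:]) i \<union> ?R ([:a, 1:] * [:b, 1:] * [:c, 1:] * [:d, 1:]) i)"
      unfolding C_def aw_generic_def by (auto simp: add_eq_0_iff2 simp del: mult_pCons_left mult_pCons_right)
    moreover have "countable \<dots>"
      by (intro countable_Un countable_UN countable_roots(2))
        (auto simp: degree_mult_eq simp del: mult_pCons_left mult_pCons_right)
    ultimately show ?thesis by (rule countable_subset)
  qed
  have reg: "(a + t, b + t, c + t, d + t) \<in> aw_regular q m" if "t \<notin> C" for t m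
    using that aw_genericD(1)[of q "a + t" "b + t" "c + t" "d + t"]
      aw_genericD(2-4)[of q "a + t" "b + t" "c + t" "d + t"]
    by (auto simp: C_def aw_regular_def qpochhammer_def prod_zero_iff)
  have reg_nz: "qpochhammer (x * y) q m * qpochhammer (x * z) q m * qpochhammer (x * w) q m / x ^ m \<noteq> 0"
    if "(x, y, z, w) \<in> aw_regular q m" for x y z w m
    using that by (simp add: aw_regular_def)
  show ?thesis
  proof (rule five_term_relation_continuous_extension[OF C,
        where v = "\<lambda>t. (a + t, b + t, c + t, d + t)" and u = u and G = "aw_regular q" and F = "aw_poly q"])
    show "((\<lambda>t. (a + t, b + t, c + t, d + t)) \<longlongrightarrow> u) (at 0)"
      unfolding u by (intro tendsto_Pair tendsto_shift)
    show "t \<noteq> 0 \<Longrightarrow> (a + t, b + t, c + t, d + t) \<noteq> u" for t by (simp add: u)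
    show "t \<notin> C \<Longrightarrow> (a + t, b + t, c + t, d + t) \<in> aw_regular q m" for t m by (rule reg)
    show "five_term_relation (\<lambda>m. aw_poly q m (a + t, b + t, c + t, d + t)) n" if "t \<notin> C" for t
    proof (rule five_term_relation_scale[OF aw_sum_five_term])
      show "aw_generic q (a + t) (b + t) (c + t) (d + t)" using that by (simp add: C_def)
      show "qpochhammer ((a + t) * (b + t)) q m * qpochhammer ((a + t) * (c + t)) q m *
          qpochhammer ((a + t) * (d + t)) q m / (a + t) ^ m \<noteq> 0 \<and>
        aw_poly q m (a + t, b + t, c + t, d + t) = smult (qpochhammer ((a + t) * (b + t)) q m *
          qpochhammer ((a + t) * (c + t)) q m * qpochhammer ((a + t) * (d + t)) q m / (a + t) ^ m)
          (aw_sum q m (a + t) (b + t) (c + t) (d + t))" for m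
        using reg_nz[OF reg[OF that]] aw_poly_eq_sum[OF reg[OF that]] by blast
    qed
    show "degree (aw_poly q m w) \<le> m" if "w \<in> aw_regular q m" for m w
    proof -
      obtain a b c d where "w = (a, b, c, d)" by (cases w) auto
      thus ?thesis using that aw_poly_eq_sum degree_aw_sum_le
        by (auto intro: order.trans[OF degree_smult_le])
    qed
    show "continuous_extension (aw_regular q m) (aw_poly q m) u (P m) \<and> degree (P m) = m" if "m \<le> n + 2" for m
      using P[OF that] by (simp add: is_askey_wilson_def)
    fix m assume um: "u \<in> aw_regular q m"
    have "coeff_tendsto (\<lambda>t. smult (qpochhammer ((a + t) * (b + t)) q m * qpochhammer ((a + t) * (c + t)) q m *
          qpochhammer ((a + t) * (d + t)) q m / (a + t) ^ m)
        (aw_sum q m (a + t) (b + t) (c + t) (d + t))) (aw_poly q m u) (at 0 within - C)"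
      unfolding u aw_poly_eq_sum[OF um[unfolded u]]
      by (intro coeff_tendsto_smult coeff_tendsto_aw_sum tendsto_divide tendsto_mult tendsto_power tendsto_qpochhammer tendsto_shift)
        (use um in \<open>auto simp: u aw_regular_def dest: qpochhammer_factor_ne_0\<close>)
    thus "coeff_tendsto (\<lambda>t. aw_poly q m (a + t, b + t, c + t, d + t)) (aw_poly q m u) (at 0 within - C)"
      by (rule coeff_tendsto_cong[rotated]) (unfold eventually_at_filter, intro always_eventually allI impI aw_poly_eq_sum reg, simp)
  qed
qed

text \<open>For each index of the sequences of parameters the previous lemma applies to finitely many members,
  and their monic multiples converge, so the relation passes to the limit once more.\<close>

lemma aw_limit_five_term:
  assumes "askey_wilson_limit_type q P" and deg: "\<And>m. degree (P m) = m"
  shows "five_term_relation P n"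
proof -
  obtain A B C D where "\<forall>n. \<exists>k L Q. k \<noteq> 0 \<and> P n = smult k L \<and>
        (\<forall>\<^sub>F m in sequentially. is_askey_wilson q n (A m, B m, C m, D m) (Q m) \<and> degree (Q m) = n \<and> Q m \<noteq> 0) \<and>
        (\<forall>i. (\<lambda>m. coeff (smult (inverse (lead_coeff (Q m))) (Q m)) i) \<longlonglongrightarrow> coeff L i)"
    using assms(1) unfolding askey_wilson_limit_type_def by blast
  then obtain k L Q where all: "\<forall>n. k n \<noteq> 0 \<and> P n = smult (k n) (L n) \<and>
        (\<forall>\<^sub>F m in sequentially. is_askey_wilson q n (A m, B m, C m, D m) (Q n m) \<and> degree (Q n m) = n \<and> Q n m \<noteq> 0) \<and>
        (\<forall>i. (\<lambda>m. coeff (smult (inverse (lead_coeff (Q n m))) (Q n m)) i) \<longlonglongrightarrow> coeff (L n) i)"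
    unfolding choice_iff by blast
  have k: "\<And>n. k n \<noteq> 0" and PL: "\<And>n. P n = smult (k n) (L n)"
    and ev: "\<And>n. \<forall>\<^sub>F m in sequentially. is_askey_wilson q n (A m, B m, C m, D m) (Q n m) \<and> degree (Q n m) = n \<and> Q n m \<noteq> 0"
    and lim: "\<And>n. coeff_tendsto (\<lambda>m. smult (inverse (lead_coeff (Q n m))) (Q n m)) (L n) sequentially"
    using all unfolding coeff_tendsto_def by blast+
  show ?thesis
  proof (rule five_term_relation_limit[where F = sequentially and
        f = "\<lambda>m j. smult (k j) (smult (inverse (lead_coeff (Q j m))) (Q j m))"])
    show "coeff_tendsto (\<lambda>m. smult (k j) (smult (inverse (lead_coeff (Q j m))) (Q j m))) (P j) sequentially" for j
      unfolding PL by (intro coeff_tendsto_smult tendsto_const lim)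
    show "\<forall>\<^sub>F m in sequentially. degree (smult (k j) (smult (inverse (lead_coeff (Q j m))) (Q j m))) \<le> j" for j
      using ev[of j] by eventually_elim (auto intro!: order.trans[OF degree_smult_le])
    have "\<forall>\<^sub>F m in sequentially. \<forall>j\<in>{..n + 2}. is_askey_wilson q j (A m, B m, C m, D m) (Q j m) \<and> degree (Q j m) = j \<and> Q j m \<noteq> 0"
      using ev by (intro eventually_ball_finite) auto
    thus "\<forall>\<^sub>F m in sequentially. five_term_relation (\<lambda>j. smult (k j) (smult (inverse (lead_coeff (Q j m))) (Q j m))) n"
    proof eventually_elim
      case (elim m)
      have "five_term_relation (\<lambda>j. Q j m) n" by (rule aw_five_term) (use elim in auto)
      thus ?case
      proof (rule five_term_relation_scale[where c = "\<lambda>j. k j * inverse (lead_coeff (Q j m))"])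
        fix j assume "j \<le> n + 2"
        hence "Q j m \<noteq> 0" using elim by simp
        hence "lead_coeff (Q j m) \<noteq> 0" unfolding leading_coeff_0_iff .
        thus "k j * inverse (lead_coeff (Q j m)) \<noteq> 0 \<and> smult (k j) (smult (inverse (lead_coeff (Q j m))) (Q j m)) =
            smult (k j * inverse (lead_coeff (Q j m))) (Q j m)"
          using k by simp
      qed
    qed
  qed (simp_all add: deg)
qed

end

text \<open>The nonzero factors by which a member of a family is determined only up to scaling are absorbed
  in the coefficients of the relation.\<close>

lemma (in lowering_operator) five_term_relation_of_multiples:
  assumes "\<And>m. \<exists>k p. k \<noteq> 0 \<and> is_member m p \<and> P m = smult k p" and deg: "\<And>m. degree (P m) = m"
    and rel: "\<And>p. (\<And>m. m \<le> n + 2 \<Longrightarrow> is_member m (p m) \<and> degree (p m) = m) \<Longrightarrow> five_term_relation p n"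
  shows "five_term_relation P n"
proof -
  obtain k p where kp: "\<And>m. k m \<noteq> 0 \<and> is_member m (p m) \<and> P m = smult (k m) (p m)"
    using assms(1) by metis
  have "degree (p m) = m" for m using kp[of m] deg[of m] by simp
  hence "five_term_relation p n" using kp by (intro rel) auto
  thus ?thesis by (rule five_term_relation_scale[where c = k]) (use kp in auto)
qed

theorem corollary4p5:
  fixes P :: "nat \<Rightarrow> complex poly" and x :: "complex \<Rightarrow> complex"
  assumes orthogonal: "orthogonal_polys P"
    and type: "(x = square_lattice \<and> (wilson_type P \<or> cdh_type P)) \<or>
      (\<exists>q::real. q > 0 \<and> q \<noteq> 1 \<and> x = q_lattice (of_real q) \<and>
         (askey_wilson_type (of_real q) P \<or> askey_wilson_limit_type (of_real q) P))"
  shows "\<exists>b :: nat \<Rightarrow> nat \<Rightarrow> complex. \<forall>n\<ge>2.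
      P n = (\<Sum>m = n - 2..n + 2. smult (b n m) (ddiff x (ddiff x (P m))))"
proof -
  have deg: "degree (P m) = m" for m using orthogonal by (simp add: orthogonal_polys_def)
  have "\<exists>b. P n = (\<Sum>m = n - 2..n + 2. smult (b m) (ddiff x (ddiff x (P m))))" if n: "n \<ge> 2" for n
    using type
  proof (elim disjE conjE exE)
    assume x: "x = square_lattice" and "wilson_type P"
    then obtain u where "\<And>m. \<exists>k p. k \<noteq> 0 \<and> is_wilson m u p \<and> P m = smult k p"
      by (auto simp: wilson_type_def)
    hence "square.five_term_relation P n"
      by (rule square.five_term_relation_of_multiples[OF _ deg wilson_five_term])
    thus ?thesis unfolding x using n by (rule square.five_term_relation_expand)
  next
    assume x: "x = square_lattice" and "cdh_type P"
    then obtain u where "\<And>m. \<exists>k p. k \<noteq> 0 \<and> is_cdh m u p \<and> P m = smult k p"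
      by (auto simp: cdh_type_def)
    hence "square.five_term_relation P n"
      by (rule square.five_term_relation_of_multiples[OF _ deg cdh_five_term])
    thus ?thesis unfolding x using n by (rule square.five_term_relation_expand)
  next
    fix q :: real
    assume q: "q > 0" "q \<noteq> 1" and x: "x = q_lattice (of_real q)" and "askey_wilson_type (of_real q) P"
    then obtain u where u: "\<And>m. \<exists>k p. k \<noteq> 0 \<and> is_askey_wilson (of_real q) m u p \<and> P m = smult k p"
      by (auto simp: askey_wilson_type_def)
    interpret q_lattice_base q "of_real q" by unfold_locales (use q in auto)
    have "five_term_relation P n"
      by (rule five_term_relation_of_multiples[OF u deg aw_five_term])
    thus ?thesis unfolding x using n by (rule five_term_relation_expand)
  next
    fix q :: real
    assume q: "q > 0" "q \<noteq> 1" and x: "x = q_lattice (of_real q)" and lim: "askey_wilson_limit_type (of_real q) P"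
    interpret q_lattice_base q "of_real q" by unfold_locales (use q in auto)
    have "five_term_relation P n" by (rule aw_limit_five_term[OF lim deg])
    thus ?thesis unfolding x using n by (rule five_term_relation_expand)
  qed
  thus ?thesis by metis
qed

end
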